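(* For a zero-dimensional $\aleph_0$-space $X$ the following conditions are equivalent: (1) $C_k(X,2)$ is metrizable or a cosmic $k_\omega$-space; (2) $C_k(X,2)$ is sequential; (3) $C_k(X,2)$ contains no strong $\mathrm{Fin}^\omega$-fan; (4) $X$ is either hemicompact or metrizable with compact set $X'$ of non-isolated points.
   Context: $C_k(X,2)$ is the set of continuous functions $f:X\to\{0,1\}$ with the compact-open topology (as a subspace of the space $C_k(X)$ of continuous real-valued functions with the compact-open topology). "Regular" includes $T_1$. A space is zero-dimensional if its clopen subsets form a base of the topology. A family $\mathcal N$ of subsets of a space $Y$ is a network if for each $y\in Y$ and neighborhood $O_y$ of $y$ there is $N\in\mathcal N$ with $y\in N\subset O_y$; it is a $k$-network if for each open $U\subset Y$ and compact $K\subset U$ there is a finite $\mathcal F\subset\mathcal N$ with $K\subset\bigcup\mathcal F\subset U$. A regular space is cosmic if it has a countable network and an $\aleph_0$-space if it has a countable $k$-network. $Y$ is hemicompact if it has a countable cover $\mathcal K$ by compact subsets such that each compact subset of $Y$ is contained in some $K\in\mathcal K$. $Y$ is a $k_\omega$-space if it has a countable cover $\mathcal K$ by compact subsets such that $F\subset Y$ is closed iff $F\cap K$ is closed in $K$ for all $K\in\mathcal K$. $Y$ is sequential if for each non-closed $A\subset Y$ some sequence of points of $A$ converges to a point of $Y\setminus A$. A family $(F_n)_{n\in\omega}$ of subsets of $Y$ is locally finite if each point of $Y$ has a neighborhood meeting $F_n$ for only finitely many $n$; it is compact-finite if each compact subset of $Y$ meets $F_n$ for only finitely many $n$. A set $U\subset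 Y$ is $\mathbb R$-open if for each $y\in U$ there is a continuous $f:Y\to[0,1]$ with $f(y)=1$ and $f(Y\setminus U)\subset\{0\}$. A $\mathrm{Fin}^\omega$-fan in $Y$ is a family $(F_n)_{n\in\omega}$ of finite subsets of $Y$ that is compact-finite but not locally finite; it is strong if each $F_n$ has an $\mathbb R$-open neighborhood $U_n\supset F_n$ such that $(U_n)_{n\in\omega}$ is compact-finite. *)

theory Defs
  imports "HOL-Analysis.Analysis"
begin

section \<open>Function spaces with the compact-open topology\<close>

text \<open>A function on the space \<open>X\<close> is represented by the extensional function that is \<open>undefined\<close>
  outside \<open>topspace X\<close>, as in the library's product topologies.\<close>

definition continuous_reals :: "'a topology \<Rightarrow> ('a \<Rightarrow> real) set" where
  "continuous_reals X = {f \<in> extensional (topspace X). continuous_map X euclideanreal f}"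

definition Ck :: "'a topology \<Rightarrow> ('a \<Rightarrow> real) topology" where
  "Ck X = topology_generated_by
     {{f \<in> continuous_reals X. f ` K \<subseteq> U} |K U. compactin X K \<and> open U}"

lemma topspace_Ck: "topspace (Ck X) = continuous_reals X"
proof -
  have "continuous_reals X \<in>
      {{f \<in> continuous_reals X. f ` K \<subseteq> U} |K U. compactin X K \<and> open U}"
    by (rule CollectI, rule exI[of _ "{}"], rule exI[of _ UNIV]) auto
  then show ?thesis
    by (auto simp: Ck_def)
qed

definition Ck2 :: "'a topology \<Rightarrow> ('a \<Rightarrow> real) topology" where
  "Ck2 X = subtopology (Ck X) {f. f ` topspace X \<subseteq> {0, 1}}"

lemma topspace_Ck2:
  "topspace (Ck2 X) = {f \<in> continuous_reals X. f ` topspace X \<subseteq> {0, 1}}"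
  by (auto simp: Ck2_def topspace_Ck)


section \<open>Classes of topological spaces\<close>

definition zero_dimensional_space :: "'a topology \<Rightarrow> bool" where
  "zero_dimensional_space X \<longleftrightarrow>
     (\<forall>U x. openin X U \<and> x \<in> U \<longrightarrow>
        (\<exists>B. openin X B \<and> closedin X B \<and> x \<in> B \<and> B \<subseteq> U))"

definition network_in :: "'a topology \<Rightarrow> 'a set set \<Rightarrow> bool" where
  "network_in Y \<N> \<longleftrightarrow> \<Union>\<N> \<subseteq> topspace Y \<and>
     (\<forall>U y. openin Y U \<and> y \<in> U \<longrightarrow> (\<exists>N\<in>\<N>. y \<in> N \<and> N \<subseteq> U))"

definition k_network_in :: "'a topology \<Rightarrow> 'a set set \<Rightarrow> bool" where
  "k_network_in Y \<N> \<longleftrightarrow> \<Union>\<N> \<subseteq> topspace Y \<and>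
     (\<forall>U K. openin Y U \<and> compactin Y K \<and> K \<subseteq> U \<longrightarrow>
        (\<exists>\<F>. finite \<F> \<and> \<F> \<subseteq> \<N> \<and> K \<subseteq> \<Union>\<F> \<and> \<Union>\<F> \<subseteq> U))"

text \<open>The library's \<^const>\<open>regular_space\<close> does not include the \<open>T\<^sub>1\<close> axiom.\<close>

definition cosmic_space :: "'a topology \<Rightarrow> bool" where
  "cosmic_space Y \<longleftrightarrow> regular_space Y \<and> t1_space Y \<and> (\<exists>\<N>. countable \<N> \<and> network_in Y \<N>)"

definition aleph0_space :: "'a topology \<Rightarrow> bool" where
  "aleph0_space Y \<longleftrightarrow> regular_space Y \<and> t1_space Y \<and> (\<exists>\<N>. countable \<N> \<and> k_network_in Y \<N>)"

definition hemicompact_space :: "'a topology \<Rightarrow> bool" where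
  "hemicompact_space Y \<longleftrightarrow>
     (\<exists>\<K>. countable \<K> \<and> (\<forall>K\<in>\<K>. compactin Y K) \<and> \<Union>\<K> = topspace Y \<and>
        (\<forall>C. compactin Y C \<longrightarrow> (\<exists>K\<in>\<K>. C \<subseteq> K)))"

definition k_omega_space :: "'a topology \<Rightarrow> bool" where
  "k_omega_space Y \<longleftrightarrow>
     (\<exists>\<K>. countable \<K> \<and> (\<forall>K\<in>\<K>. compactin Y K) \<and> \<Union>\<K> = topspace Y \<and>
        (\<forall>F. F \<subseteq> topspace Y \<longrightarrow>
           (closedin Y F \<longleftrightarrow> (\<forall>K\<in>\<K>. closedin (subtopology Y K) (F \<inter> K)))))"

definition sequential_space :: "'a topology \<Rightarrow> bool" where
  "sequential_space Y \<longleftrightarrow>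
     (\<forall>A. A \<subseteq> topspace Y \<and> \<not> closedin Y A \<longrightarrow>
        (\<exists>(\<sigma> :: nat \<Rightarrow> 'a) l. range \<sigma> \<subseteq> A \<and> l \<in> topspace Y - A \<and> limitin Y \<sigma> l sequentially))"

definition non_isolated_points :: "'a topology \<Rightarrow> 'a set" where
  "non_isolated_points X = {x \<in> topspace X. \<not> openin X {x}}"


section \<open>Fans\<close>

text \<open>The library's \<^const>\<open>locally_finite_in\<close> concerns sets of sets; here the family is indexed, so
  a set occurring for infinitely many indices counts infinitely often.\<close>

definition locally_finite_family :: "'a topology \<Rightarrow> (nat \<Rightarrow> 'a set) \<Rightarrow> bool" where
  "locally_finite_family Y F \<longleftrightarrow>
     (\<forall>y\<in>topspace Y. \<exists>V. openin Y V \<and> y \<in> V \<and> finite {n. F n \<inter> V \<noteq> {}})"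

definition compact_finite_family :: "'a topology \<Rightarrow> (nat \<Rightarrow> 'a set) \<Rightarrow> bool" where
  "compact_finite_family Y F \<longleftrightarrow>
     (\<forall>K. compactin Y K \<longrightarrow> finite {n. F n \<inter> K \<noteq> {}})"

definition R_open_in :: "'a topology \<Rightarrow> 'a set \<Rightarrow> bool" where
  "R_open_in Y U \<longleftrightarrow> U \<subseteq> topspace Y \<and>
     (\<forall>y\<in>U. \<exists>f :: 'a \<Rightarrow> real. continuous_map Y (top_of_set {0..1}) f \<and>
        f y = 1 \<and> f ` (topspace Y - U) \<subseteq> {0})"

definition Fin_fan :: "'a topology \<Rightarrow> (nat \<Rightarrow> 'a set) \<Rightarrow> bool" where
  "Fin_fan Y F \<longleftrightarrow> (\<forall>n. finite (F n) \<and> F n \<subseteq> topspace Y) \<and>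
     compact_finite_family Y F \<and> \<not> locally_finite_family Y F"

definition strong_Fin_fan :: "'a topology \<Rightarrow> (nat \<Rightarrow> 'a set) \<Rightarrow> bool" where
  "strong_Fin_fan Y F \<longleftrightarrow> Fin_fan Y F \<and>
     (\<exists>U. (\<forall>n. R_open_in Y (U n) \<and> F n \<subseteq> U n) \<and> compact_finite_family Y U)"

end

theory Submission
  imports Defs
begin

text \<open>
  The only hard step is the construction of a strong fan when (4) fails. Fix a countable
  \<open>k\<close>-network \<open>\<N>\<close> of closed sets, closed under finite unions, and let \<open>Q(N)\<close> be the set of
  functions in \<open>Ck2 X\<close> vanishing on \<open>N\<close>.

  If \<open>X\<close> is not hemicompact, some compact \<open>K\<^sub>0\<close> is not contained in any compact finite
  intersection of members of \<open>\<N>\<close>, so there are closed noncompact sets \<open>A\<^sub>m\<close> shrinking to \<open>K\<^sub>0\<close>.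
  Each \<open>A\<^sub>m\<close> contains points \<open>d\<^sub>m\<^sub>k\<close> lying in the members of a locally finite sequence of clopen
  sets, while any choice of one \<open>d\<^sub>m\<^sub>k\<close> for each \<open>m\<close> forms together with \<open>K\<^sub>0\<close> a compact set.

  If some compact \<open>K\<close> has \<open>Q(N)\<close> compact for every \<open>N \<in> \<N>\<close> containing \<open>K\<close>, then all these \<open>N\<close> have
  only isolated points outside, and the open members of \<open>\<N>\<close> form a countable clopen base: \<open>X\<close> is
  metrizable and its non-isolated points lie in \<open>K\<close>. Otherwise every compact set lies in some
  \<open>N \<in> \<N>\<close> for which \<open>Q(N)\<close> contains functions \<open>b\<^sub>N\<^sub>k\<close> lying in the members of a locally finite
  sequence of clopen subsets of \<open>Ck2 X\<close>. Perturbing \<open>b\<^sub>N\<^sub>k\<close> to take the value \<open>1\<close> at \<open>d\<^sub>m\<^sub>k\<close>, where \<open>N\<close>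
  is the \<open>m\<close>-th such set, yields a strong fan at \<open>0\<close>: each row is locally finite because of \<open>b\<close>,
  and a compact set of functions meets only finitely many rows because of \<open>d\<close>.
\<close>

section \<open>The topology of \<open>Ck2 X\<close>\<close>

text \<open>For \<open>f\<close> in \<open>Ck2 X\<close> and compact \<open>K\<close> these sets are
  the basic neighbourhoods of \<open>f\<close>. The prescribed function may be arbitrary, for
  instance a constant that is not extensional.\<close>

definition agreeing :: "'a topology \<Rightarrow> ('a \<Rightarrow> real) \<Rightarrow> 'a set \<Rightarrow> ('a \<Rightarrow> real) set" where
  "agreeing X f K = {g \<in> topspace (Ck2 X). \<forall>x\<in>K. g x = f x}"

definition char_fun :: "'a topology \<Rightarrow> 'a set \<Rightarrow> 'a \<Rightarrow> real" where
  "char_fun X B = (\<lambda>x\<in>topspace X. if x \<in> B then 1 else 0)"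

lemma Ck2_values: "f \<in> topspace (Ck2 X) \<Longrightarrow> x \<in> topspace X \<Longrightarrow> f x = 0 \<or> f x = 1"
  by (auto simp: topspace_Ck2)

lemma Ck2_ext:
  assumes "f \<in> topspace (Ck2 X)" "g \<in> topspace (Ck2 X)" "\<And>x. x \<in> topspace X \<Longrightarrow> f x = g x"
  shows "f = g"
  using assms by (auto simp: topspace_Ck2 continuous_reals_def intro: extensionalityI)

lemma Ck2_fibre:
  assumes "f \<in> topspace (Ck2 X)"
  shows "openin X {x \<in> topspace X. f x = c}" "closedin X {x \<in> topspace X. f x = c}"
proof -
  have cont: "continuous_map X euclideanreal f" and "f ` topspace X \<subseteq> {0, 1}"
    using assms by (auto simp: topspace_Ck2 continuous_reals_def)
  then have eq: "{x \<in> topspace X. f x = c} = {x \<in> topspace X. f x \<in> - ({0, 1} - {c})}"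
    by auto
  have "open (- ({0, 1} - {c}))"
    by (intro open_Compl finite_imp_closed) auto
  then show "openin X {x \<in> topspace X. f x = c}"
    unfolding eq using cont by (auto simp: continuous_map_def)
  show "closedin X {x \<in> topspace X. f x = c}"
    using closedin_continuous_map_preimage[OF cont, of "{c}"] by auto
qed

lemma Ck2_memI:
  assumes "f \<in> extensional (topspace X)"
    and "\<And>x. x \<in> topspace X \<Longrightarrow> f x = 0 \<or> f x = 1"
    and "openin X {x \<in> topspace X. f x = 0}" "openin X {x \<in> topspace X. f x = 1}"
  shows "f \<in> topspace (Ck2 X)"
proof -
  have "openin X {x \<in> topspace X. f x \<in> U}" for U
  proof -
    have "{x \<in> topspace X. f x \<in> U} =
        (if 0 \<in> U then {x \<in> topspace X. f x = 0} else {}) \<union>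
        (if 1 \<in> U then {x \<in> topspace X. f x = 1} else {})"
      using assms(2) by auto metis+
    then show ?thesis
      using assms(3,4) by auto
  qed
  then have "continuous_map X euclideanreal f"
    by (auto simp: continuous_map_def)
  then show ?thesis
    using assms(1,2) by (auto simp: topspace_Ck2 continuous_reals_def)
qed

lemma char_fun_in_Ck2:
  assumes "openin X B" "closedin X B"
  shows "char_fun X B \<in> topspace (Ck2 X)"
proof (rule Ck2_memI)
  have "{x \<in> topspace X. char_fun X B x = 0} = topspace X - B"
    "{x \<in> topspace X. char_fun X B x = 1} = B"
    using openin_subset[OF assms(1)] by (auto simp: char_fun_def)
  then show "openin X {x \<in> topspace X. char_fun X B x = 0}"
    "openin X {x \<in> topspace X. char_fun X B x = 1}"
    using assms by auto
qed (auto simp: char_fun_def)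

text \<open>Membership in a subbasic set depends only on the values on its compact set, and a finite
  intersection only on the values on the union of the compact sets involved. For real-valued
  functions agreement sets need not be open; the converse direction uses that only the values 0 and
  1 occur.\<close>

lemma openin_Ck_agreeing:
  assumes "openin (Ck X) U" "f \<in> U"
  shows "\<exists>K. compactin X K \<and> {g \<in> continuous_reals X. \<forall>x\<in>K. g x = f x} \<subseteq> U"
proof -
  have "generate_topology_on
      {{f \<in> continuous_reals X. f ` K \<subseteq> U} |K U. compactin X K \<and> open U} U"
    using assms(1) unfolding Ck_def by (rule openin_topology_generated_by)
  then show ?thesis
    using assms(2)
  proof (induction arbitrary: f rule: generate_topology_on.induct)
    case (Int a b)
    obtain K where "compactin X K" "{g \<in> continuous_reals X. \<forall>x\<in>K. g x = f x} \<subseteq> a"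
      using Int.IH(1)[of f] Int.prems by blast
    moreover obtain L where "compactin X L" "{g \<in> continuous_reals X. \<forall>x\<in>L. g x = f x} \<subseteq> b"
      using Int.IH(2)[of f] Int.prems by blast
    ultimately show ?case
      by (intro exI[of _ "K \<union> L"]) (auto simp: compactin_Un)
  next
    case (UN A)
    then obtain k where k: "k \<in> A" "f \<in> k"
      by blast
    then show ?case
      using UN.IH[OF k] by blast
  next
    case (Basis s)
    then obtain K V where "s = {f \<in> continuous_reals X. f ` K \<subseteq> V}" "compactin X K"
      by blast
    then show ?case
      using Basis by (intro exI[of _ K]) auto
  qed auto
qed

text \<open>With only two values, \<open>g\<close> equals \<open>f\<close> on \<open>K\<close> iff
  it avoids 1 on the part of \<open>K\<close> where \<open>f\<close> is 0 and avoids 0 on the part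
  where \<open>f\<close> is 1. Both parts are compact because the fibres of \<open>f\<close> are
  closed, so this is an intersection of two subbasic sets.\<close>

lemma openin_Ck2_agreeing_self:
  assumes f: "f \<in> topspace (Ck2 X)" and K: "compactin X K"
  shows "openin (Ck2 X) (agreeing X f K)"
proof -
  let ?B = "\<lambda>K U. {f \<in> continuous_reals X. f ` K \<subseteq> U}"
  define K0 where "K0 = {x \<in> topspace X. f x = 0} \<inter> K"
  define K1 where "K1 = {x \<in> topspace X. f x = 1} \<inter> K"
  have "compactin X K0" "compactin X K1"
    unfolding K0_def K1_def using Ck2_fibre[OF f] K by (auto intro: closed_Int_compactin)
  moreover have opB: "openin (Ck X) (?B L U)" if "compactin X L" "open U" for L U
    unfolding Ck_def using that by (intro topology_generated_by_Basis) blast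
  ultimately have "openin (Ck X) (?B K0 (-{1}))" "openin (Ck X) (?B K1 (-{0}))"
    using open_Compl[OF closed_singleton] by (blast intro!: opB)+
  then have op: "openin (Ck X) (?B K0 (-{1}) \<inter> ?B K1 (-{0}))"
    by blast
  have K_sub: "K \<subseteq> topspace X"
    using K compactin_subset_topspace by blast
  define W where "W = ?B K0 (-{1}) \<inter> ?B K1 (-{0})"
  have "g \<in> agreeing X f K \<longleftrightarrow> g \<in> W" if g: "g \<in> topspace (Ck2 X)" for g
  proof -
    have "g x = f x \<longleftrightarrow> (f x = 0 \<longrightarrow> g x \<noteq> 1) \<and> (f x = 1 \<longrightarrow> g x \<noteq> 0)" if "x \<in> K" for x
      using Ck2_values[OF f, of x] Ck2_values[OF g, of x] K_sub that by auto
    then have "(\<forall>x\<in>K. g x = f x) \<longleftrightarrow> (\<forall>x\<in>K0. g x \<noteq> 1) \<and> (\<forall>x\<in>K1. g x \<noteq> 0)"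
      using K_sub unfolding K0_def K1_def by blast
    then show ?thesis
      using g by (auto simp: agreeing_def topspace_Ck2 W_def)
  qed
  moreover have "agreeing X f K \<subseteq> topspace (Ck2 X)"
    by (auto simp: agreeing_def)
  ultimately have "agreeing X f K = W \<inter> topspace (Ck2 X)"
    by blast
  then show ?thesis
    using op unfolding W_def[symmetric] Ck2_def topspace_subtopology
    by (metis openin_subtopology_Int openin_Int openin_topspace Int_assoc)
qed

lemma openin_Ck2_iff:
  "openin (Ck2 X) U \<longleftrightarrow>
     U \<subseteq> topspace (Ck2 X) \<and> (\<forall>f\<in>U. \<exists>K. compactin X K \<and> agreeing X f K \<subseteq> U)"
proof (intro iffI conjI ballI)
  fix f assume U: "openin (Ck2 X) U" "f \<in> U"
  then obtain V where V: "openin (Ck X) V" "U = V \<inter> {f. f ` topspace X \<subseteq> {0, 1}}"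
    unfolding Ck2_def openin_subtopology by auto
  then obtain K where "compactin X K" "{g \<in> continuous_reals X. \<forall>x\<in>K. g x = f x} \<subseteq> V"
    using openin_Ck_agreeing[OF V(1), of f] U(2) by auto
  then show "\<exists>K. compactin X K \<and> agreeing X f K \<subseteq> U"
    using V(2) by (intro exI[of _ K]) (auto simp: agreeing_def topspace_Ck2)
next
  assume R: "U \<subseteq> topspace (Ck2 X) \<and> (\<forall>f\<in>U. \<exists>K. compactin X K \<and> agreeing X f K \<subseteq> U)"
  show "openin (Ck2 X) U"
  proof (subst openin_subopen, intro ballI)
    fix f assume "f \<in> U"
    then obtain K where "compactin X K" "agreeing X f K \<subseteq> U"
      using R by blast
    then show "\<exists>T. openin (Ck2 X) T \<and> f \<in> T \<and> T \<subseteq> U"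
      using R \<open>f \<in> U\<close> openin_Ck2_agreeing_self[of f X K]
      by (intro exI[of _ "agreeing X f K"]) (auto simp: agreeing_def)
  qed
qed (auto dest: openin_subset)

text \<open>Both the set and its complement are unions of sets
  \<open>agreeing X f K\<close>.\<close>

lemma Ck2_clopen_by_compact:
  assumes "compactin X K"
    and "\<And>f g. f \<in> topspace (Ck2 X) \<Longrightarrow> g \<in> topspace (Ck2 X) \<Longrightarrow> (\<forall>x\<in>K. f x = g x) \<Longrightarrow> P f = P g"
  shows "openin (Ck2 X) {f \<in> topspace (Ck2 X). P f}"
    and "closedin (Ck2 X) {f \<in> topspace (Ck2 X). P f}"
proof -
  have op: "openin (Ck2 X) {f \<in> topspace (Ck2 X). P f}"
    if "\<And>f g. f \<in> topspace (Ck2 X) \<Longrightarrow> g \<in> topspace (Ck2 X) \<Longrightarrow> (\<forall>x\<in>K. f x = g x) \<Longrightarrow> P f = P g" for P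
    unfolding openin_Ck2_iff agreeing_def using assms(1) that by auto
  show "openin (Ck2 X) {f \<in> topspace (Ck2 X). P f}"
    using op[OF assms(2)] .
  have "openin (Ck2 X) {f \<in> topspace (Ck2 X). \<not> P f}"
    using op[of "\<lambda>f. \<not> P f"] assms(2) by blast
  moreover have "topspace (Ck2 X) - {f \<in> topspace (Ck2 X). P f} = {f \<in> topspace (Ck2 X). \<not> P f}"
    by auto
  ultimately show "closedin (Ck2 X) {f \<in> topspace (Ck2 X). P f}"
    by (auto simp: closedin_def)
qed

lemma agreeing_clopen:
  assumes "compactin X K"
  shows "openin (Ck2 X) (agreeing X f K)" "closedin (Ck2 X) (agreeing X f K)"
  unfolding agreeing_def by (rule Ck2_clopen_by_compact[OF assms]; simp)+

lemma zero_dimensional_Ck2: "zero_dimensional_space (Ck2 X)"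
  unfolding zero_dimensional_space_def
proof (intro allI impI)
  fix U f assume U: "openin (Ck2 X) U \<and> f \<in> U"
  then obtain K where K: "compactin X K" "agreeing X f K \<subseteq> U"
    by (meson openin_Ck2_iff)
  have "f \<in> agreeing X f K"
    using U openin_subset[of "Ck2 X" U] by (auto simp: agreeing_def)
  then show "\<exists>B. openin (Ck2 X) B \<and> closedin (Ck2 X) B \<and> f \<in> B \<and> B \<subseteq> U"
    using agreeing_clopen[OF K(1), of f] K(2) by (intro exI[of _ "agreeing X f K"] conjI)
qed

lemma zero_dimensional_imp_regular_space:
  assumes "zero_dimensional_space X" shows "regular_space X"
  unfolding regular_space_def
proof (intro allI impI)
  fix C a assume C: "closedin X C \<and> a \<in> topspace X - C"
  then have "openin X (topspace X - C)" "a \<in> topspace X - C"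
    by auto
  then obtain B where "openin X B" "closedin X B" "a \<in> B" "B \<subseteq> topspace X - C"
    using assms unfolding zero_dimensional_space_def by metis
  then show "\<exists>U V. openin X U \<and> openin X V \<and> a \<in> U \<and> C \<subseteq> V \<and> disjnt U V"
    using C closedin_subset[of X C] by (intro exI[of _ B] exI[of _ "topspace X - B"]) (auto simp: disjnt_def)
qed

lemma t1_space_Ck2: "t1_space (Ck2 X)"
  unfolding t1_space_def
proof (intro ballI impI)
  fix f g assume fg: "f \<in> topspace (Ck2 X)" "g \<in> topspace (Ck2 X)" "f \<noteq> g"
  then obtain x where "x \<in> topspace X" "f x \<noteq> g x"
    using Ck2_ext by blast
  then show "\<exists>U. openin (Ck2 X) U \<and> f \<in> U \<and> g \<notin> U"
    using fg agreeing_clopen[of X "{x}" f]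
    by (intro exI[of _ "agreeing X f {x}"]) (auto simp: agreeing_def)
qed

text \<open>A network member prescribes the value 1 on one finite union from the
  \<open>k\<close>-network and the value 0 on another. Given \<open>f\<close> and a compact
  \<open>K\<close>, the two unions are squeezed between the fibres of \<open>f\<close> within
  \<open>K\<close> and the full fibres, so the member contains \<open>f\<close> and forces agreement
  with it on \<open>K\<close>.\<close>

lemma cosmic_space_Ck2:
  assumes "aleph0_space X"
  shows "cosmic_space (Ck2 X)"
proof -
  obtain \<N> where \<N>: "countable \<N>" "k_network_in X \<N>"
    using assms unfolding aleph0_space_def by blast
  let ?fin = "{\<F>. finite \<F> \<and> \<F> \<subseteq> \<N>}"
  define \<M> where "\<M> = (\<lambda>(\<F>, \<G>). {f \<in> topspace (Ck2 X). (\<forall>x\<in>\<Union>\<F>. f x = 1) \<and> (\<forall>x\<in>\<Union>\<G>. f x = 0)}) `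
      (?fin \<times> ?fin)"
  have "countable \<M>"
    unfolding \<M>_def using \<N>(1) by (intro countable_image countable_SIGMA countable_Collect_finite_subset)
  moreover have "network_in (Ck2 X) \<M>"
    unfolding network_in_def
  proof (intro conjI allI impI)
    show "\<Union>\<M> \<subseteq> topspace (Ck2 X)"
      by (auto simp: \<M>_def)
    fix U f assume U: "openin (Ck2 X) U \<and> f \<in> U"
    then have f: "f \<in> topspace (Ck2 X)"
      using openin_subset[of "Ck2 X" U] by auto
    obtain K where K: "compactin X K" "agreeing X f K \<subseteq> U"
      using U by (meson openin_Ck2_iff)
    have "\<exists>\<F>. finite \<F> \<and> \<F> \<subseteq> \<N> \<and> {x \<in> topspace X. f x = c} \<inter> K \<subseteq> \<Union>\<F> \<and>
            \<Union>\<F> \<subseteq> {x \<in> topspace X. f x = c}" for c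
      using \<N>(2)[unfolded k_network_in_def, THEN conjunct2, rule_format,
          OF conjI[OF Ck2_fibre(1)[OF f, of c] conjI[OF closed_Int_compactin[OF Ck2_fibre(2)[OF f, of c] K(1)] Int_lower1]]] .
    then have "\<forall>c. \<exists>\<F>. finite \<F> \<and> \<F> \<subseteq> \<N> \<and> {x \<in> topspace X. f x = c} \<inter> K \<subseteq> \<Union>\<F> \<and>
            \<Union>\<F> \<subseteq> {x \<in> topspace X. f x = c}"
      by (rule allI)
    from choice[OF this] obtain \<F> where "\<forall>c. finite (\<F> c) \<and> \<F> c \<subseteq> \<N> \<and>
        {x \<in> topspace X. f x = c} \<inter> K \<subseteq> \<Union>(\<F> c) \<and> \<Union>(\<F> c) \<subseteq> {x \<in> topspace X. f x = c}"
      by (rule exE)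
    then have \<F>: "finite (\<F> c)" "\<F> c \<subseteq> \<N>" "{x \<in> topspace X. f x = c} \<inter> K \<subseteq> \<Union>(\<F> c)"
      "\<Union>(\<F> c) \<subseteq> {x \<in> topspace X. f x = c}" for c
      by simp_all
    let ?M = "{g \<in> topspace (Ck2 X). (\<forall>x\<in>\<Union>(\<F> 1). g x = 1) \<and> (\<forall>x\<in>\<Union>(\<F> 0). g x = 0)}"
    have M1: "?M \<in> \<M>"
      unfolding \<M>_def using \<F>(1,2) by (intro image_eqI[of _ _ "(\<F> 1, \<F> 0)"]) auto
    have M2: "f \<in> ?M"
      using f \<F>(4)[of 0] \<F>(4)[of 1] by blast
    have M3: "?M \<subseteq> agreeing X f K"
    proof
      fix g assume g: "g \<in> ?M"
      have "g x = f x" if "x \<in> K" for x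
      proof -
        have "x \<in> topspace X"
          using that compactin_subset_topspace[OF K(1)] by blast
        then consider "f x = 0" "x \<in> \<Union>(\<F> 0)" | "f x = 1" "x \<in> \<Union>(\<F> 1)"
          using Ck2_values[OF f, of x] \<F>(3)[of 0] \<F>(3)[of 1] \<open>x \<in> K\<close> by blast
        then show ?thesis
          using g by cases auto
      qed
      then show "g \<in> agreeing X f K"
        using g by (auto simp: agreeing_def)
    qed
    show "\<exists>N\<in>\<M>. f \<in> N \<and> N \<subseteq> U"
      using M2 order_trans[OF M3 K(2)] by (intro bexI[OF _ M1] conjI)
  qed
  ultimately show ?thesis
    unfolding cosmic_space_def
    using t1_space_Ck2 zero_dimensional_imp_regular_space[OF zero_dimensional_Ck2] by blast
qed

text \<open>A compact subset of \<open>Ck2 X\<close> is compact, hence closed, for the topology of pointwise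
  convergence.\<close>

lemma compactin_Ck2_pointwise:
  assumes "compactin (Ck2 X) Q" "D \<subseteq> topspace X"
    and fin: "\<And>E. finite E \<Longrightarrow> E \<subseteq> D \<Longrightarrow> \<exists>g\<in>Q. \<forall>x\<in>E. g x = h x"
  shows "\<exists>g\<in>Q. \<forall>x\<in>D. g x = h x"
proof (rule ccontr)
  assume no: "\<not> (\<exists>g\<in>Q. \<forall>x\<in>D. g x = h x)"
  define V where "V x = {g \<in> topspace (Ck2 X). g x \<noteq> h x}" for x
  have "openin (Ck2 X) (V x)" if "x \<in> D" for x
    unfolding V_def using that assms(2) by (intro Ck2_clopen_by_compact(1)[of X "{x}"]) auto
  moreover have "Q \<subseteq> \<Union>(V ` D)"
    using no compactin_subset_topspace[OF assms(1)] unfolding V_def by auto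
  ultimately obtain \<F> where "finite \<F>" "\<F> \<subseteq> V ` D" "Q \<subseteq> \<Union>\<F>"
    using compactinD[OF assms(1), of "V ` D"] by blast
  then obtain E where E: "finite E" "E \<subseteq> D" "\<F> = V ` E"
    using finite_subset_image by metis
  then obtain g where "g \<in> Q" "\<forall>x\<in>E. g x = h x"
    using fin[of E] by auto
  then show False
    using \<open>Q \<subseteq> \<Union>\<F>\<close> E(3) by (auto simp: V_def)
qed

text \<open>The restriction map \<open>f \<mapsto> f|K\<close> is locally constant.\<close>

lemma compactin_Ck2_finite_restrictions:
  assumes "compactin (Ck2 X) Q" "compactin X K"
  shows "\<exists>E. finite E \<and> E \<subseteq> Q \<and> (\<forall>g\<in>Q. \<exists>f\<in>E. \<forall>x\<in>K. g x = f x)"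
proof -
  have sub: "Q \<subseteq> topspace (Ck2 X)"
    using assms(1) compactin_subset_topspace by blast
  have "openin (Ck2 X) U" if "U \<in> (\<lambda>f. agreeing X f K) ` Q" for U
    using that agreeing_clopen(1)[OF assms(2)] by auto
  moreover have "Q \<subseteq> \<Union>((\<lambda>f. agreeing X f K) ` Q)"
    using sub by (auto simp: agreeing_def)
  ultimately obtain \<F> where \<F>: "finite \<F>" "\<F> \<subseteq> (\<lambda>f. agreeing X f K) ` Q" "Q \<subseteq> \<Union>\<F>"
    using compactinD[OF assms(1), of "(\<lambda>f. agreeing X f K) ` Q"] by auto
  then obtain E where "finite E" "E \<subseteq> Q" "\<F> = (\<lambda>f. agreeing X f K) ` E"
    using finite_subset_image by metis
  then show ?thesis
    using \<F>(3) by (auto simp: agreeing_def subset_iff)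
qed


section \<open>Metrizability, sequentiality and locally finite families\<close>

text \<open>The first index at which the maps tell two points apart defines an ultrametric; its
  balls are the sets on which an initial segment of the maps keeps its values.\<close>

lemma metrizable_spaceI_separating_maps:
  fixes \<phi> :: "nat \<Rightarrow> 'a \<Rightarrow> 'b"
  assumes sep: "\<And>x y. x \<in> topspace X \<Longrightarrow> y \<in> topspace X \<Longrightarrow> (\<And>n. \<phi> n x = \<phi> n y) \<Longrightarrow> x = y"
    and op: "\<And>U. openin X U \<longleftrightarrow> U \<subseteq> topspace X \<and>
               (\<forall>x\<in>U. \<exists>n. {y \<in> topspace X. \<forall>i<n. \<phi> i y = \<phi> i x} \<subseteq> U)"
  shows "metrizable_space X"
proof -
  \<comment> \<open>For equal points no index separates and \<open>LEAST\<close> is unspecified;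
    \<open>d\<close> therefore treats equality on its own.\<close>
  define m where "m x y = (LEAST n. \<phi> n x \<noteq> \<phi> n y)" for x y
  define d :: "'a \<Rightarrow> 'a \<Rightarrow> real" where "d x y = (if x = y then 0 else 1 / (1 + real (m x y)))" for x y
  let ?T = "topspace X"
  have m: "\<phi> (m x y) x \<noteq> \<phi> (m x y) y" if "x \<in> ?T" "y \<in> ?T" "x \<noteq> y" for x y
    using sep[OF that(1,2)] that(3) LeastI_ex[of "\<lambda>n. \<phi> n x \<noteq> \<phi> n y"] unfolding m_def by auto
  have m_le: "\<phi> i x = \<phi> i y" if "i < m x y" for i x y
    using not_less_Least[of i "\<lambda>n. \<phi> n x \<noteq> \<phi> n y"] that by (auto simp: m_def)
  have m_sym: "m x y = m y x" for x y
    unfolding m_def by (simp add: eq_commute)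
  have m_ge: "n \<le> m x y" if "x \<in> ?T" "y \<in> ?T" "x \<noteq> y" "\<forall>i<n. \<phi> i x = \<phi> i y" for n x y
    using m[OF that(1-3)] that(4) by (auto simp flip: not_less)
  interpret Metric_space ?T d
  proof
    show "0 \<le> d x y" for x y
      by (auto simp: d_def)
    show "d x y = d y x" for x y
      by (auto simp: d_def m_sym)
    show "d x y = 0 \<longleftrightarrow> x = y" for x y
      by (auto simp: d_def add_nonneg_eq_0_iff)
    fix x y z assume T: "x \<in> ?T" "y \<in> ?T" "z \<in> ?T"
    show "d x z \<le> d x y + d y z"
    proof (cases "x = y \<or> y = z \<or> x = z")
      case False
      have "min (m x y) (m y z) \<le> m x z"
        using False T m_le[of _ x y] m_le[of _ y z] by (intro m_ge) auto
      then have "d x z \<le> max (d x y) (d y z)"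
        using False by (auto simp: d_def min_def max_def field_simps split: if_splits)
      also have "\<dots> \<le> d x y + d y z"
        by (auto simp: d_def)
      finally show ?thesis .
    qed (auto simp: d_def)
  qed
  have "openin mtopology U \<longleftrightarrow> openin X U" for U
  proof -
    have "(\<exists>r>0. mball x r \<subseteq> U) \<longleftrightarrow> (\<exists>n. {y \<in> ?T. \<forall>i<n. \<phi> i y = \<phi> i x} \<subseteq> U)" if "x \<in> ?T" for x
    proof
      assume "\<exists>r>0. mball x r \<subseteq> U"
      then obtain r where r: "r > 0" "mball x r \<subseteq> U"
        by blast
      obtain n where n: "1 / (1 + real n) < r"
        using r(1) nat_approx_posE[of r] by (metis of_nat_Suc add.commute)
      have "y \<in> mball x r" if y: "y \<in> ?T" "\<forall>i<n. \<phi> i y = \<phi> i x" for y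
      proof (cases "x = y")
        case False
        then have "n \<le> m x y"
          using y \<open>x \<in> ?T\<close> by (intro m_ge) auto
        then have "d x y \<le> 1 / (1 + real n)"
          using False by (simp add: d_def frac_le)
        then show ?thesis
          using n y(1) \<open>x \<in> ?T\<close> by simp
      qed (use r that in auto)
      then show "\<exists>n. {y \<in> ?T. \<forall>i<n. \<phi> i y = \<phi> i x} \<subseteq> U"
        using r(2) by blast
    next
      assume "\<exists>n. {y \<in> ?T. \<forall>i<n. \<phi> i y = \<phi> i x} \<subseteq> U"
      then obtain n where n: "{y \<in> ?T. \<forall>i<n. \<phi> i y = \<phi> i x} \<subseteq> U"
        by blast
      have "y \<in> U" if y: "y \<in> mball x (1 / (1 + real n))" for y
      proof (cases "x = y")
        case False
        have "1 / (1 + real (m x y)) < 1 / (1 + real n)" "y \<in> ?T"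
          using y False by (auto simp: d_def)
        then have "n < m x y"
          by (simp add: field_simps)
        then show ?thesis
          using n m_le[of _ x y] \<open>y \<in> ?T\<close> by fastforce
      qed (use n that in auto)
      then show "\<exists>r>0. mball x r \<subseteq> U"
        by (intro exI[of _ "1 / (1 + real n)"]) auto
    qed
    then show ?thesis
      unfolding openin_mtopology op[of U] by (meson subsetD)
  qed
  then have "X = mtopology"
    by (simp add: topology_eq)
  then show ?thesis
    using metrizable_space_mtopology by simp
qed

lemma metrizable_imp_sequential_space:
  assumes "metrizable_space X"
  shows "sequential_space X"
proof -
  obtain M d where M: "Metric_space M d" "X = Metric_space.mtopology M d"
    using assms unfolding metrizable_space_def by blast
  interpret Metric_space M d
    by (rule M(1))
  show ?thesis
    unfolding sequential_space_def M(2) metric_closedin_iff_sequentially_closed topspace_mtopology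
    by (metis Diff_iff limitin_mspace)
qed

text \<open>Compact subsets are Frechet: around \<open>l\<close> there are countably many open sets whose closures
  meet only in \<open>l\<close>, and by compactness their finite intersections are eventually inside
  each neighbourhood of \<open>l\<close>.\<close>

lemma cosmic_k_omega_imp_sequential_space:
  assumes "cosmic_space Y" "k_omega_space Y"
  shows "sequential_space Y"
  unfolding sequential_space_def
proof (intro allI impI)
  fix A assume A: "A \<subseteq> topspace Y \<and> \<not> closedin Y A"
  obtain \<K> where \<K>: "\<forall>K\<in>\<K>. compactin Y K"
    "\<forall>F. F \<subseteq> topspace Y \<longrightarrow> (closedin Y F \<longleftrightarrow> (\<forall>K\<in>\<K>. closedin (subtopology Y K) (F \<inter> K)))"
    using assms(2) unfolding k_omega_space_def by blast
  then obtain K where K: "K \<in> \<K>" "\<not> closedin (subtopology Y K) (A \<inter> K)"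
    using A by blast
  then have Kc: "compactin Y K"
    using \<K>(1) by blast
  have reg: "regular_space Y" and t1: "t1_space Y" and "\<exists>\<N>. countable \<N> \<and> network_in Y \<N>"
    using assms(1) unfolding cosmic_space_def by blast+
  then obtain \<N> where \<N>: "countable \<N>" "network_in Y \<N>"
    by blast
  obtain l where l: "l \<in> K" "l \<notin> A" "\<And>U. openin Y U \<Longrightarrow> l \<in> U \<Longrightarrow> A \<inter> K \<inter> U \<noteq> {}"
  proof -
    have "\<exists>l\<in>K. l \<notin> A \<and> l \<in> Y closure_of (A \<inter> K)"
    proof (rule ccontr)
      assume "\<not> ?thesis"
      moreover have "A \<inter> K \<subseteq> Y closure_of (A \<inter> K)"
        using A by (intro closure_of_subset) auto
      ultimately have "A \<inter> K = (Y closure_of (A \<inter> K)) \<inter> K"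
        by blast
      then show False
        using K(2) closedin_subtopology[of Y K "A \<inter> K"] closedin_closure_of[of Y "A \<inter> K"] by auto
    qed
    then obtain l where l: "l \<in> K" "l \<notin> A" "l \<in> Y closure_of (A \<inter> K)"
      by auto
    have "A \<inter> K \<inter> U \<noteq> {}" if "openin Y U" "l \<in> U" for U
    proof -
      have "\<exists>y. y \<in> A \<inter> K \<and> y \<in> U"
        using l(3) that unfolding in_closure_of by simp
      then show ?thesis
        by auto
    qed
    then show ?thesis
      using that l(1,2) by simp
  qed
  have lY: "l \<in> topspace Y"
    using l(1) compactin_subset_topspace[OF Kc] by blast
  \<comment> \<open>These are the network members disjoint from the closure of some neighbourhood of
    \<open>l\<close>. By regularity they cover every point except \<open>l\<close>, and there are
    only countably many of them.\<close>
  define \<N>' where "\<N>' = {N \<in> \<N>. \<exists>V. openin Y V \<and> l \<in> V \<and> disjnt N (Y closure_of V)}"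
  have "\<forall>N. \<exists>V. N \<in> \<N>' \<longrightarrow> openin Y V \<and> l \<in> V \<and> disjnt N (Y closure_of V)"
    by (auto simp: \<N>'_def)
  from choice[OF this] obtain V where
    V: "\<And>N. N \<in> \<N>' \<Longrightarrow> openin Y (V N) \<and> l \<in> V N \<and> disjnt N (Y closure_of (V N))"
    by auto
  have ex: "\<exists>N\<in>\<N>'. y \<in> N" if y: "y \<in> topspace Y" "y \<noteq> l" for y
  proof -
    have "closedin Y {y}"
      using t1 y(1) by (simp add: closedin_t1_singleton)
    then obtain W where W: "openin Y W" "l \<in> W" "disjnt {y} (Y closure_of W)"
      using reg lY y(2) unfolding regular_space by (metis Diff_iff singletonD)
    have "openin Y (topspace Y - Y closure_of W)" "y \<in> topspace Y - Y closure_of W"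
      using W(3) y(1) by (auto simp: disjnt_def)
    then obtain N where "N \<in> \<N>" "y \<in> N" "N \<subseteq> topspace Y - Y closure_of W"
      using \<N>(2) unfolding network_in_def by metis
    then show ?thesis
      using W by (intro bexI[of _ N]) (auto simp: \<N>'_def disjnt_def)
  qed
  have "countable \<N>'"
    unfolding \<N>'_def using \<N>(1) by simp
  \<comment> \<open>The membership test guards against an empty \<N>', where
    \<open>from_nat_into\<close> returns an arbitrary set; the factor \<open>topspace Y\<close>
    handles an empty intersection.\<close>
  define W where "W n = topspace Y \<inter> (\<Inter>i\<in>{i. i < n \<and> from_nat_into \<N>' i \<in> \<N>'}. V (from_nat_into \<N>' i))" for n :: nat
  have W: "openin Y (W n)" "l \<in> W n" for n
  proof -
    let ?I = "{i. i < n \<and> from_nat_into \<N>' i \<in> \<N>'}"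
    have "W n = (if ?I = {} then topspace Y else topspace Y \<inter> (\<Inter>i\<in>?I. V (from_nat_into \<N>' i)))"
      by (auto simp: W_def)
    moreover have "openin Y (\<Inter>i\<in>?I. V (from_nat_into \<N>' i))" if "?I \<noteq> {}"
      using that V by (intro openin_Inter) auto
    ultimately show "openin Y (W n)"
      by auto
    show "l \<in> W n"
      using V lY by (auto simp: W_def)
  qed
  have "\<exists>a. a \<in> A \<inter> K \<inter> W n" for n
    using l(3)[OF W] by blast
  then obtain a where a: "a n \<in> A \<inter> K \<inter> W n" for n
    by metis
  have "limitin Y a l sequentially"
    unfolding limitin_def
  proof (intro conjI lY allI impI)
    fix U assume U: "openin Y U \<and> l \<in> U"
    have "compactin Y (K \<inter> (topspace Y - U))"
      using U Kc by (intro compact_Int_closedin) auto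
    moreover have "K \<inter> (topspace Y - U) \<subseteq> \<Union>((\<lambda>N. topspace Y - Y closure_of (V N)) ` \<N>')"
    proof
      fix y assume "y \<in> K \<inter> (topspace Y - U)"
      then have y: "y \<in> topspace Y" "y \<noteq> l"
        using U by auto
      then obtain N where "N \<in> \<N>'" "y \<in> N"
        using ex by blast
      then show "y \<in> \<Union>((\<lambda>N. topspace Y - Y closure_of (V N)) ` \<N>')"
        using V[of N] y(1) by (auto simp: disjnt_def)
    qed
    moreover have "openin Y U" if "U \<in> (\<lambda>N. topspace Y - Y closure_of (V N)) ` \<N>'" for U
      using that by auto
    ultimately obtain \<F> where \<F>: "finite \<F>" "\<F> \<subseteq> (\<lambda>N. topspace Y - Y closure_of (V N)) ` \<N>'"
      "K \<inter> (topspace Y - U) \<subseteq> \<Union>\<F>"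
      using compactinD[of Y "K \<inter> (topspace Y - U)" "(\<lambda>N. topspace Y - Y closure_of (V N)) ` \<N>'"] by meson
    then obtain E where E: "finite E" "E \<subseteq> \<N>'" "\<F> = (\<lambda>N. topspace Y - Y closure_of (V N)) ` E"
      using finite_subset_image[OF \<F>(1,2)] by blast
    obtain b where b: "\<forall>i\<in>to_nat_on \<N>' ` E. i < b"
      using E(1) finite_nat_set_iff_bounded[of "to_nat_on \<N>' ` E"] by auto
    have "a n \<in> U" if "b \<le> n" for n
    proof (rule ccontr)
      assume "a n \<notin> U"
      then have "a n \<in> K \<inter> (topspace Y - U)"
        using a[of n] by (auto simp: W_def)
      then obtain N where N: "N \<in> E" "a n \<notin> Y closure_of (V N)"
        using \<F>(3) E(3) by blast
      have N': "N \<in> \<N>'"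
        using N(1) E(2) by blast
      then have "from_nat_into \<N>' (to_nat_on \<N>' N) = N" "to_nat_on \<N>' N < n"
        using \<open>countable \<N>'\<close> b N(1) that by (auto intro: less_le_trans)
      then have "W n \<subseteq> V N"
        using N' by (force simp: W_def)
      then have "a n \<in> V N"
        using a[of n] by blast
      then show False
        using N(2) V[OF N'] closure_of_subset[of "V N" Y] openin_subset[of Y "V N"] by blast
    qed
    then show "\<forall>\<^sub>F n in sequentially. a n \<in> U"
      unfolding eventually_sequentially by blast
  qed
  then show "\<exists>(\<sigma> :: nat \<Rightarrow> 'a) l. range \<sigma> \<subseteq> A \<and> l \<in> topspace Y - A \<and> limitin Y \<sigma> l sequentially"
    using a lY l(2) by blast
qed

text \<open>At a point \<open>y\<close> where local finiteness fails, the union of the sets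
  \<open>F n\<close> without \<open>y\<close> is not closed, since only finitely many
  \<open>F n\<close> contain \<open>y\<close>. A sequence in this union converging outside it forms
  with its limit a compact set, so it runs through finitely many finite sets. Finite sets are closed
  in a T1 space, hence the limit cannot lie outside.\<close>

lemma sequential_imp_no_Fin_fan:
  assumes seq: "sequential_space Y" and t1: "t1_space Y"
  shows "\<not> Fin_fan Y F"
proof
  assume F: "Fin_fan Y F"
  then have fin: "finite (F n)" "F n \<subseteq> topspace Y" for n
    unfolding Fin_fan_def by blast+
  have cf: "finite {n. F n \<inter> K \<noteq> {}}" if "compactin Y K" for K
    using F that unfolding Fin_fan_def compact_finite_family_def by blast
  obtain y where y: "y \<in> topspace Y" "\<And>V. openin Y V \<Longrightarrow> y \<in> V \<Longrightarrow> infinite {n. F n \<inter> V \<noteq> {}}"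
    using F unfolding Fin_fan_def locally_finite_family_def by blast
  have fy: "finite {n. F n \<inter> {y} \<noteq> {}}"
    using cf[of "{y}"] y(1) by simp
  define A where "A = (\<Union>n. F n - {y})"
  have A: "A \<subseteq> topspace Y"
    using fin(2) by (auto simp: A_def)
  have "\<not> closedin Y A"
  proof
    assume "closedin Y A"
    then have "openin Y (topspace Y - A)" "y \<in> topspace Y - A"
      using y(1) by (auto simp: A_def)
    then have "infinite {n. F n \<inter> (topspace Y - A) \<noteq> {}}"
      using y(2) by blast
    moreover have "{n. F n \<inter> (topspace Y - A) \<noteq> {}} \<subseteq> {n. F n \<inter> {y} \<noteq> {}}"
      by (auto simp: A_def)
    ultimately show False
      using fy finite_subset by blast
  qed
  then obtain \<sigma> :: "nat \<Rightarrow> 'a" and l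
    where \<sigma>: "range \<sigma> \<subseteq> A" "l \<in> topspace Y - A" "limitin Y \<sigma> l sequentially"
    using seq A unfolding sequential_space_def by blast
  have "compactin Y (insert l (range \<sigma>))"
    using \<sigma>(1,3) A by (intro compactin_sequence_with_limit) auto
  then have fin': "finite {n. F n \<inter> insert l (range \<sigma>) \<noteq> {}}"
    by (rule cf)
  define S where "S = (\<Union>n\<in>{n. F n \<inter> insert l (range \<sigma>) \<noteq> {}}. F n - {y})"
  have "finite S"
    unfolding S_def using fin' fin(1) by blast
  have "\<sigma> i \<in> S" for i
  proof -
    have "\<sigma> i \<in> A"
      using \<sigma>(1) by auto
    then obtain n where "\<sigma> i \<in> F n - {y}"
      by (auto simp: A_def)
    then show ?thesis
      unfolding S_def by (intro UN_I[of n]) auto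
  qed
  have "S \<subseteq> A"
    unfolding S_def A_def by auto
  have "closedin Y S"
    using t1 \<open>finite S\<close> order_trans[OF \<open>S \<subseteq> A\<close> A] unfolding t1_space_closedin_finite by simp
  then have "openin Y (topspace Y - S)" "l \<in> topspace Y - S"
    using \<sigma>(2) \<open>S \<subseteq> A\<close> by auto
  then have "\<forall>\<^sub>F n in sequentially. \<sigma> n \<in> topspace Y - S"
    using \<sigma>(3) unfolding limitin_def by meson
  then show False
    using \<open>\<And>i. \<sigma> i \<in> S\<close> unfolding eventually_sequentially by auto
qed

lemma locally_finite_imp_compact_finite:
  assumes "locally_finite_family Y F"
  shows "compact_finite_family Y F"
  unfolding compact_finite_family_def
proof (intro allI impI)
  fix K assume K: "compactin Y K"
  define \<V> where "\<V> = {V. openin Y V \<and> finite {n. F n \<inter> V \<noteq> {}}}"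
  have "K \<subseteq> \<Union>\<V>"
    using assms compactin_subset_topspace[OF K] unfolding locally_finite_family_def \<V>_def by blast
  then obtain \<F> where \<F>: "finite \<F>" "\<F> \<subseteq> \<V>" "K \<subseteq> \<Union>\<F>"
    using compactinD[OF K, of \<V>] by (auto simp: \<V>_def)
  have "{n. F n \<inter> K \<noteq> {}} \<subseteq> (\<Union>V\<in>\<F>. {n. F n \<inter> V \<noteq> {}})"
    using \<F>(3) by blast
  moreover have "finite (\<Union>V\<in>\<F>. {n. F n \<inter> V \<noteq> {}})"
    using \<F>(1,2) unfolding \<V>_def by blast
  ultimately show "finite {n. F n \<inter> K \<noteq> {}}"
    using finite_subset by blast
qed

text \<open>The characteristic function serves every point of the set; this supplies the
  neighbourhoods that make a fan strong.\<close>

lemma clopen_imp_R_open: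
  assumes "openin Y U" "closedin Y U"
  shows "R_open_in Y U"
proof -
  define f :: "'a \<Rightarrow> real" where "f y = (if y \<in> U then 1 else 0)" for y
  have "continuous_map Y euclideanreal f"
    unfolding continuous_map_def
  proof (intro conjI allI impI)
    fix V :: "real set"
    have "{x \<in> topspace Y. f x \<in> V} =
        (if 1 \<in> V then U else {}) \<union> (if 0 \<in> V then topspace Y - U else {})"
      using openin_subset[OF assms(1)] by (auto simp: f_def)
    then show "openin Y {x \<in> topspace Y. f x \<in> V}"
      using assms by auto
  qed auto
  then have "continuous_map Y (top_of_set {0..1}) f"
    by (auto simp: continuous_map_in_subtopology f_def)
  then show ?thesis
    unfolding R_open_in_def using openin_subset[OF assms(1)]
    by (intro conjI ballI exI[of _ f]) (auto simp: f_def)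
qed

text \<open>An open cover of \<open>N\<close> without finite subcover is refined, thanks to the
  countable network, by a countable clopen cover of the whole space, which is then made disjoint.
  Infinitely many pieces must meet \<open>N\<close>, as otherwise finitely many members of the cover
  would suffice. Each piece is a neighbourhood of its points that meets no other piece.\<close>

lemma zero_dimensional_noncompact_partition:
  assumes zd: "zero_dimensional_space X" and net: "countable \<N>" "network_in X \<N>"
    and N: "closedin X N" "\<not> compactin X N"
  shows "\<exists>P :: nat \<Rightarrow> 'a set. (\<forall>k. openin X (P k) \<and> closedin X (P k) \<and> P k \<inter> N \<noteq> {}) \<and>
      locally_finite_family X P"
proof -
  obtain \<U> where \<U>0: "(\<forall>U\<in>\<U>. openin X U) \<and> N \<subseteq> \<Union>\<U>"
    "\<not> (\<exists>\<F>. finite \<F> \<and> \<F> \<subseteq> \<U> \<and> N \<subseteq> \<Union>\<F>)"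
    using N(2) closedin_subset[OF N(1)] unfolding compactin_def by metis
  then have \<U>: "\<forall>U\<in>\<U>. openin X U" "N \<subseteq> \<Union>\<U>"
    and nofin: "\<And>\<F>. finite \<F> \<Longrightarrow> \<F> \<subseteq> \<U> \<Longrightarrow> \<not> N \<subseteq> \<Union>\<F>"
    by simp_all
  \<comment> \<open>Only the trace on \<open>N\<close> has to fit into a member of the cover, so the
    complement of \<open>N\<close> is good and points off \<open>N\<close> are covered too.\<close>
  define good where "good B \<longleftrightarrow> (\<exists>U\<in>\<U>. B \<inter> N \<subseteq> U)" for B
  obtain U0 where U0: "U0 \<in> \<U>"
    using nofin[of "{}"] \<U>(2) by auto
  have ex: "\<exists>B. openin X B \<and> closedin X B \<and> good B \<and> x \<in> B" if "x \<in> topspace X" for x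
  proof -
    have "\<exists>U. openin X U \<and> x \<in> U \<and> good U"
    proof (cases "x \<in> N")
      case True
      then show ?thesis
        using \<U> unfolding good_def by (meson UnionE Int_lower1 subsetD)
    next
      case False
      then show ?thesis
        using that N(1) U0 by (intro exI[of _ "topspace X - N"]) (auto simp: good_def)
    qed
    then obtain U where U: "openin X U" "x \<in> U" "good U"
      by blast
    then obtain B where "openin X B" "closedin X B" "x \<in> B" "B \<subseteq> U"
      using zd unfolding zero_dimensional_space_def by metis
    moreover obtain V where "V \<in> \<U>" "U \<inter> N \<subseteq> V"
      using U(3) by (auto simp: good_def)
    then have "good B"
      unfolding good_def using \<open>B \<subseteq> U\<close> by (intro bexI[of _ V]) auto
    ultimately show ?thesis
      by (intro exI[of _ B]) simp
  qed
  \<comment> \<open>Choosing one clopen set for each network member, not for each point, makes the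
    cover countable.\<close>
  define \<M> where "\<M> = {M \<in> \<N>. \<exists>B. openin X B \<and> closedin X B \<and> good B \<and> M \<subseteq> B}"
  have "\<forall>M. \<exists>B. M \<in> \<M> \<longrightarrow> openin X B \<and> closedin X B \<and> good B \<and> M \<subseteq> B"
    unfolding \<M>_def by blast
  from choice[OF this] obtain B where
    B: "\<And>M. M \<in> \<M> \<Longrightarrow> openin X (B M) \<and> closedin X (B M) \<and> good (B M) \<and> M \<subseteq> B M"
    by auto
  have cover: "\<exists>M\<in>\<M>. x \<in> M" if x: "x \<in> topspace X" for x
  proof -
    obtain C where C: "openin X C" "closedin X C" "good C" "x \<in> C"
      using ex[OF x] by blast
    then obtain M where "M \<in> \<N>" "x \<in> M" "M \<subseteq> C"
      using net(2) unfolding network_in_def by metis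
    then show ?thesis
      using C unfolding \<M>_def by (intro bexI[of _ M]) auto
  qed
  have "countable \<M>"
    unfolding \<M>_def using net(1) by simp
  have "N \<noteq> {}"
    using nofin[of "{}"] by auto
  then have "\<M> \<noteq> {}"
    using cover closedin_subset[OF N(1)] by auto
  define b where "b i = B (from_nat_into \<M> i)" for i
  have b: "openin X (b i)" "closedin X (b i)" "good (b i)" for i
    using B[OF from_nat_into[OF \<open>\<M> \<noteq> {}\<close>]] unfolding b_def by blast+
  have bcover: "\<exists>i. x \<in> b i" if x: "x \<in> topspace X" for x
  proof -
    obtain M where "M \<in> \<M>" "x \<in> M"
      using cover[OF x] by auto
    moreover obtain i where "from_nat_into \<M> i = M"
      using from_nat_into_surj[OF \<open>countable \<M>\<close> \<open>M \<in> \<M>\<close>] by auto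
    ultimately show ?thesis
      using B[of M] by (intro exI[of _ i]) (auto simp: b_def)
  qed
  \<comment> \<open>Only finitely many clopen sets are subtracted from each \<open>b i\<close>, so
    the disjoint pieces stay clopen.\<close>
  define c where "c = disjointed b"
  have c: "openin X (c i)" "closedin X (c i)" for i
  proof -
    have "closedin X (\<Union>j\<in>{0..<i}. b j)"
      by (intro closedin_Union) (auto simp: b)
    moreover have "openin X (\<Union>j\<in>{0..<i}. b j)"
      by (intro openin_Union) (auto simp: b)
    ultimately show "openin X (c i)" "closedin X (c i)"
      unfolding c_def disjointed_def using b by (auto intro: openin_diff closedin_diff)
  qed
  have csub: "c i \<subseteq> b i" for i
    unfolding c_def by (rule disjointed_subset)
  have ccover: "\<exists>i. x \<in> c i" if "x \<in> topspace X" for x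
    using bcover[OF that] UN_disjointed_eq[of b] unfolding c_def by (metis UNIV_I UN_iff)
  have cdisj: "i = j" if "x \<in> c i" "x \<in> c j" for x i j
    using disjoint_family_disjointed[of b] that unfolding c_def disjoint_family_on_def by blast
  define I where "I = {i. c i \<inter> N \<noteq> {}}"
  have "infinite I"
  proof
    assume "finite I"
    obtain u where u: "\<And>i. u i \<in> \<U> \<and> b i \<inter> N \<subseteq> u i"
    proof -
      have "\<forall>i. \<exists>v. v \<in> \<U> \<and> b i \<inter> N \<subseteq> v"
        using b(3) unfolding good_def by auto
      from choice[OF this] show ?thesis
        using that by auto
    qed
    have "N \<subseteq> \<Union>(u ` I)"
    proof
      fix x assume "x \<in> N"
      then obtain i where "x \<in> c i"
        using ccover[of x] closedin_subset[OF N(1)] by auto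
      then show "x \<in> \<Union>(u ` I)"
        using \<open>x \<in> N\<close> u[of i] csub[of i] unfolding I_def by (intro UN_I[of i]) auto
    qed
    then show False
      using nofin[of "u ` I"] \<open>finite I\<close> u by auto
  qed
  define P where "P k = c (enumerate I k)" for k
  have "locally_finite_family X P"
    unfolding locally_finite_family_def
  proof
    fix x assume "x \<in> topspace X"
    then obtain i where i: "x \<in> c i"
      using ccover by blast
    have "k = k'" if "P k \<inter> c i \<noteq> {}" "P k' \<inter> c i \<noteq> {}" for k k'
    proof -
      have "enumerate I k = i" "enumerate I k' = i"
        using that cdisj unfolding P_def by auto
      then show ?thesis
        using \<open>infinite I\<close> by (metis enumerate_mono less_irrefl linorder_neqE_nat)
    qed
    then have "\<exists>k. {k. P k \<inter> c i \<noteq> {}} \<subseteq> {k}"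
      by blast
    then have "finite {k. P k \<inter> c i \<noteq> {}}"
      by (meson finite.emptyI finite.insertI finite_subset)
    then show "\<exists>V. openin X V \<and> x \<in> V \<and> finite {n. P n \<inter> V \<noteq> {}}"
      using i c(1)[of i] by (intro exI[of _ "c i"]) simp
  qed
  moreover have "P k \<inter> N \<noteq> {}" for k
    using enumerate_in_set[OF \<open>infinite I\<close>, of k] unfolding P_def I_def by blast
  ultimately show ?thesis
    using c by (intro exI[of _ P]) (simp add: P_def)
qed


section \<open>Hemicompact spaces and metrizable spaces with compact derived set\<close>

text \<open>Restrictions to an enumeration of the witnessing compact sets serve as separating maps:
  finitely many of them amount to restriction to one compact union, and every compact set lies in a
  single member.\<close>

lemma hemicompact_imp_metrizable_Ck2:
  assumes "hemicompact_space X"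
  shows "metrizable_space (Ck2 X)"
proof -
  obtain \<K> where \<K>: "countable \<K>" "\<And>K. K \<in> \<K> \<Longrightarrow> compactin X K" "\<Union>\<K> = topspace X"
    "\<And>C. compactin X C \<Longrightarrow> \<exists>K\<in>\<K>. C \<subseteq> K"
    using assms unfolding hemicompact_space_def by metis
  have "\<K> \<noteq> {}"
    using \<K>(4)[of "{}"] by auto
  define K where "K n = from_nat_into \<K> n" for n
  have K: "compactin X (K n)" for n
    unfolding K_def using \<K>(2) from_nat_into[OF \<open>\<K> \<noteq> {}\<close>] by simp
  have K_surj: "\<exists>n. L = K n" if "L \<in> \<K>" for L
    using from_nat_into_surj[OF \<K>(1) that] unfolding K_def by metis
  show ?thesis
  proof (rule metrizable_spaceI_separating_maps[where \<phi> = "\<lambda>n f. restrict f (K n)"])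
    fix f g assume fg: "f \<in> topspace (Ck2 X)" "g \<in> topspace (Ck2 X)"
      "\<And>n. restrict f (K n) = restrict g (K n)"
    show "f = g"
    proof (rule Ck2_ext[OF fg(1,2)])
      fix x assume "x \<in> topspace X"
      then obtain L where "L \<in> \<K>" "x \<in> L"
        using \<K>(3) by auto
      then obtain n where "x \<in> K n"
        using K_surj by auto
      then show "f x = g x"
        using fg(3)[of n] by (metis restrict_apply')
    qed
  next
    fix U
    have "(\<exists>C. compactin X C \<and> agreeing X f C \<subseteq> U) \<longleftrightarrow>
        (\<exists>n. {g \<in> topspace (Ck2 X). \<forall>i<n. restrict g (K i) = restrict f (K i)} \<subseteq> U)" for f
    proof
      assume "\<exists>C. compactin X C \<and> agreeing X f C \<subseteq> U"
      then obtain C where C: "compactin X C" "agreeing X f C \<subseteq> U"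
        by auto
      then obtain n where n: "C \<subseteq> K n"
        using \<K>(4)[OF C(1)] K_surj by metis
      have "g \<in> agreeing X f C"
        if g: "g \<in> topspace (Ck2 X)" "\<forall>i<Suc n. restrict g (K i) = restrict f (K i)" for g
      proof -
        have "restrict g (K n) = restrict f (K n)"
          using g(2) by simp
        then have "g x = f x" if "x \<in> C" for x
          using n that by (metis restrict_apply' subsetD)
        then show ?thesis
          using g(1) by (simp add: agreeing_def)
      qed
      then show "\<exists>n. {g \<in> topspace (Ck2 X). \<forall>i<n. restrict g (K i) = restrict f (K i)} \<subseteq> U"
        using C(2) by (intro exI[of _ "Suc n"]) auto
    next
      assume "\<exists>n. {g \<in> topspace (Ck2 X). \<forall>i<n. restrict g (K i) = restrict f (K i)} \<subseteq> U"
      then obtain n where n: "{g \<in> topspace (Ck2 X). \<forall>i<n. restrict g (K i) = restrict f (K i)} \<subseteq> U"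
        by auto
      have "compactin X (\<Union>(K ` {..<n}))"
        using K by (intro compactin_Union) auto
      moreover have "agreeing X f (\<Union>(K ` {..<n})) \<subseteq> U"
      proof
        fix g assume g: "g \<in> agreeing X f (\<Union>(K ` {..<n}))"
        then have "restrict g (K i) = restrict f (K i)" if "i < n" for i
          using that by (auto simp: agreeing_def restrict_def fun_eq_iff)
        then show "g \<in> U"
          using n g by (auto simp: agreeing_def)
      qed
      ultimately show "\<exists>C. compactin X C \<and> agreeing X f C \<subseteq> U"
        by blast
    qed
    then show "openin (Ck2 X) U \<longleftrightarrow> U \<subseteq> topspace (Ck2 X) \<and>
        (\<forall>f\<in>U. \<exists>n. {g \<in> topspace (Ck2 X). \<forall>i<n. restrict g (K i) = restrict f (K i)} \<subseteq> U)"
      unfolding openin_Ck2_iff by simp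
  qed
qed

section \<open>Metrizable spaces with compact set of non-isolated points\<close>

lemma openin_Ck2_equalizer:
  assumes f: "f \<in> topspace (Ck2 X)" and g: "g \<in> topspace (Ck2 X)"
  shows "openin X {x \<in> topspace X. f x = g x}"
proof -
  have "{x \<in> topspace X. f x = g x} =
      ({x \<in> topspace X. f x = 0} \<inter> {x \<in> topspace X. g x = 0}) \<union>
      ({x \<in> topspace X. f x = 1} \<inter> {x \<in> topspace X. g x = 1})"
    using Ck2_values[OF f] Ck2_values[OF g] by fastforce
  then show ?thesis
    using Ck2_fibre(1)[OF f] Ck2_fibre(1)[OF g] by (simp add: openin_Int openin_Un)
qed

text \<open>A finite subcover of \<open>K\<close> leaves only finitely many points of
  \<open>S\<close>. This makes a set compact when it consists of \<open>K\<close> and points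
  accumulating only at \<open>K\<close>.\<close>

lemma compactin_Un_almost_covered:
  assumes K: "compactin X K" and S: "S \<subseteq> topspace X"
    and fin: "\<And>U. openin X U \<Longrightarrow> K \<subseteq> U \<Longrightarrow> finite (S - U)"
  shows "compactin X (K \<union> S)"
  unfolding compactin_def
proof (intro conjI allI impI)
  show "K \<union> S \<subseteq> topspace X"
    using S compactin_subset_topspace[OF K] by blast
  fix \<U> assume \<U>: "(\<forall>U\<in>\<U>. openin X U) \<and> K \<union> S \<subseteq> \<Union>\<U>"
  then obtain \<F> where \<F>: "finite \<F>" "\<F> \<subseteq> \<U>" "K \<subseteq> \<Union>\<F>"
    using compactinD[OF K, of \<U>] by auto
  have "openin X (\<Union>\<F>)"
    using \<U> \<F>(2) by (intro openin_Union) auto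
  then have "finite (S - \<Union>\<F>)"
    using fin \<F>(3) by simp
  moreover have "S - \<Union>\<F> \<subseteq> topspace X"
    using S by auto
  ultimately have "compactin X (S - \<Union>\<F>)"
    by (intro finite_imp_compactin) auto
  moreover have "S - \<Union>\<F> \<subseteq> \<Union>\<U>"
    using \<U> by auto
  ultimately obtain \<G> where \<G>: "finite \<G>" "\<G> \<subseteq> \<U>" "S - \<Union>\<F> \<subseteq> \<Union>\<G>"
    using compactinD[of X "S - \<Union>\<F>" \<U>] \<U> by auto
  have "K \<union> S \<subseteq> \<Union>(\<F> \<union> \<G>)"
    using \<F>(3) \<G>(3) by auto
  then show "\<exists>\<F>. finite \<F> \<and> \<F> \<subseteq> \<U> \<and> K \<union> S \<subseteq> \<Union>\<F>"
    using \<F> \<G> by (intro exI[of _ "\<F> \<union> \<G>"]) simp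
qed

lemma metrizable_compact_neighbourhood_base:
  assumes "metrizable_space X" "compactin X K"
  shows "\<exists>W :: nat \<Rightarrow> 'a set. (\<forall>n. openin X (W n) \<and> K \<subseteq> W n) \<and> (\<forall>m n. m \<le> n \<longrightarrow> W n \<subseteq> W m) \<and>
    (\<forall>U. openin X U \<and> K \<subseteq> U \<longrightarrow> (\<exists>n. W n \<subseteq> U))"
proof -
  obtain M d where M: "Metric_space M d" "X = Metric_space.mtopology M d"
    using assms(1) unfolding metrizable_space_def by blast
  interpret Metric_space M d
    by (rule M(1))
  have KM: "K \<subseteq> M"
    using compactin_subset_topspace[OF assms(2)] M(2) by simp
  define W where "W n = (\<Union>x\<in>K. mball x (1 / (1 + real n)))" for n
  have 1: "openin X (W n)" for n
    unfolding W_def M(2) by (intro openin_Union) auto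
  have 2: "K \<subseteq> W n" for n
    unfolding W_def using KM by (intro subsetI UN_I) auto
  have 3: "W n \<subseteq> W m" if "m \<le> n" for m n
  proof -
    have "1 / (1 + real n) \<le> 1 / (1 + real m)"
      using that by (simp add: frac_le)
    then have "mball x (1 / (1 + real n)) \<subseteq> mball x (1 / (1 + real m))" for x
      by (rule mball_subset_concentric)
    then show ?thesis
      unfolding W_def by (intro UN_mono) auto
  qed
  have 4: "\<exists>n. W n \<subseteq> U" if U: "openin X U" "K \<subseteq> U" for U
  proof -
    \<comment> \<open>Half radii leave room for the triangle inequality: a point within
      \<open>r z\<close> of some \<open>x\<close>, which is itself within \<open>r z\<close> of the
      centre \<open>z\<close>, is within \<open>2 * r z\<close> of \<open>z\<close>.\<close>
    have "\<exists>r. r > 0 \<and> mball x (2 * r) \<subseteq> U" if x: "x \<in> K" for x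
    proof -
      obtain r where "r > 0" "mball x r \<subseteq> U"
        using U subsetD[OF U(2) x] unfolding M(2) openin_mtopology by auto
      then show ?thesis
        by (intro exI[of _ "r / 2"]) auto
    qed
    then obtain r where r: "\<And>x. x \<in> K \<Longrightarrow> r x > 0" "\<And>x. x \<in> K \<Longrightarrow> mball x (2 * r x) \<subseteq> U"
      by metis
    have "K \<subseteq> \<Union>((\<lambda>x. mball x (r x)) ` K)"
      using r(1) KM by (intro subsetI UN_I) auto
    moreover have "openin X B" if "B \<in> (\<lambda>x. mball x (r x)) ` K" for B
      using that M(2) by auto
    ultimately obtain \<F> where \<F>: "finite \<F>" "\<F> \<subseteq> (\<lambda>x. mball x (r x)) ` K" "K \<subseteq> \<Union>\<F>"
      using compactinD[OF assms(2), of "(\<lambda>x. mball x (r x)) ` K"] by meson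
    then obtain E where E: "finite E" "E \<subseteq> K" "\<F> = (\<lambda>x. mball x (r x)) ` E"
      using finite_subset_image[OF \<F>(1,2)] by auto
    \<comment> \<open>The element 1 keeps the minimum meaningful when \<open>E\<close> is
      empty.\<close>
    define s where "s = Min (insert 1 (r ` E))"
    have s: "s > 0" "\<And>x. x \<in> E \<Longrightarrow> s \<le> r x"
      unfolding s_def using E(1,2) r(1) by auto
    obtain n where n: "1 / (1 + real n) < s"
      using nat_approx_posE[OF s(1)] by (metis of_nat_Suc add.commute)
    have "W n \<subseteq> U"
    proof
      fix y assume "y \<in> W n"
      then obtain x where x: "x \<in> K" "y \<in> mball x (1 / (1 + real n))"
        unfolding W_def by auto
      then obtain z where z: "z \<in> E" "x \<in> mball z (r z)"
        using \<F>(3) E(3) by auto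
      have "d z y \<le> d z x + d x y"
        using x z E(2) KM by (intro triangle) auto
      also have "\<dots> < 2 * r z"
        using x(2) z(2) n s(2)[OF z(1)] by simp
      finally have "y \<in> mball z (2 * r z)"
        using x(2) z(2) by simp
      then show "y \<in> U"
        using r(2)[of z] z(1) E(2) by blast
    qed
    then show ?thesis ..
  qed
  show ?thesis
    using 1 2 3 4 by (intro exI[of _ W]) simp
qed

text \<open>The restriction of \<open>f\<close> to \<open>K\<close> is determined by the part of
  \<open>K\<close> where \<open>f\<close> is 1, and the \<open>k\<close>-network cuts this part out
  by one of countably many finite unions. One function is chosen for each finite subfamily that
  occurs.\<close>

lemma countable_restrictions_to_compact:
  assumes X: "aleph0_space X" and K: "compactin X K"
  shows "\<exists>\<E>. countable \<E> \<and> \<E> \<subseteq> topspace (Ck2 X) \<and>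
    (\<forall>f\<in>topspace (Ck2 X). \<exists>e\<in>\<E>. \<forall>x\<in>K. f x = e x)"
proof -
  obtain \<N> where \<N>: "countable \<N>" "k_network_in X \<N>"
    using X unfolding aleph0_space_def by blast
  define R where "R \<F> e \<longleftrightarrow> e \<in> topspace (Ck2 X) \<and> (\<forall>x\<in>K. e x = 1 \<longleftrightarrow> x \<in> \<Union>\<F>)" for \<F> e
  define G where "G = {\<F>. finite \<F> \<and> \<F> \<subseteq> \<N>} \<inter> {\<F>. \<exists>e. R \<F> e}"
  define h where "h \<F> = (SOME e. R \<F> e)" for \<F>
  have h: "R \<F> (h \<F>)" if "\<F> \<in> G" for \<F>
    using that someI_ex[of "R \<F>"] unfolding G_def h_def by auto
  have "countable (h ` G)"
    unfolding G_def by (intro countable_image countable_Int1 countable_Collect_finite_subset \<N>(1))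
  moreover have "h ` G \<subseteq> topspace (Ck2 X)"
    using h unfolding R_def by auto
  moreover have "\<exists>e\<in>h ` G. \<forall>x\<in>K. f x = e x" if f: "f \<in> topspace (Ck2 X)" for f
  proof -
    have "\<exists>\<F>. finite \<F> \<and> \<F> \<subseteq> \<N> \<and> {x \<in> topspace X. f x = 1} \<inter> K \<subseteq> \<Union>\<F> \<and> \<Union>\<F> \<subseteq> {x \<in> topspace X. f x = 1}"
      using \<N>(2)[unfolded k_network_in_def, THEN conjunct2, rule_format,
          OF conjI[OF Ck2_fibre(1)[OF f, of 1] conjI[OF closed_Int_compactin[OF Ck2_fibre(2)[OF f, of 1] K] Int_lower1]]] .
    then obtain \<F> where \<F>: "finite \<F>" "\<F> \<subseteq> \<N>" "{x \<in> topspace X. f x = 1} \<inter> K \<subseteq> \<Union>\<F>"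
      "\<Union>\<F> \<subseteq> {x \<in> topspace X. f x = 1}"
      by auto
    have 1: "f x = 1 \<longleftrightarrow> x \<in> \<Union>\<F>" if "x \<in> K" for x
      using that \<F>(3,4) compactin_subset_topspace[OF K] by blast
    then have "\<F> \<in> G"
      unfolding G_def R_def using \<F>(1,2) f by auto
    have "f x = h \<F> x" if "x \<in> K" for x
    proof -
      have "h \<F> x = 1 \<longleftrightarrow> x \<in> \<Union>\<F>" "h \<F> \<in> topspace (Ck2 X)"
        using h[OF \<open>\<F> \<in> G\<close>] that by (auto simp: R_def)
      then show ?thesis
        using 1[OF that] Ck2_values[OF f, of x] Ck2_values[of "h \<F>" X x] compactin_subset_topspace[OF K] that
        by auto
    qed
    then show ?thesis
      using \<open>\<F> \<in> G\<close> by auto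
  qed
  ultimately show ?thesis
    by (intro exI[of _ "h ` G"]) simp
qed

text \<open>The set is a continuous image of the compact power of \<open>{0, 1}\<close> with
  exponent \<open>D\<close>. Every assignment on \<open>D\<close> glues continuously to
  \<open>e\<close>, because \<open>D\<close> is closed and all its subsets are open. The gluing map
  is continuous because a compact set meets \<open>D\<close> in finitely many points, so only
  finitely many coordinates matter.\<close>

lemma compactin_Ck2_vary_on_discrete:
  assumes D: "closedin X D" "\<And>x. x \<in> D \<Longrightarrow> openin X {x}" and e: "e \<in> topspace (Ck2 X)"
  shows "compactin (Ck2 X) (agreeing X e (topspace X - D))"
proof -
  let ?P = "product_topology (\<lambda>_. discrete_topology {0, 1 :: real}) D"
  have D_sub: "D \<subseteq> topspace X"
    using D(1) closedin_subset by auto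
  have sub_open: "openin X S" if "S \<subseteq> D" for S
  proof -
    have "openin X (\<Union>x\<in>S. {x})"
      using that D(2) by (intro openin_Union) auto
    then show ?thesis
      by simp
  qed
  have fin: "finite (K \<inter> D)" if "compactin X K" for K
  proof -
    have "compactin X (K \<inter> D)"
      using that D(1) by (rule compact_Int_closedin)
    moreover have "openin X U" if "U \<in> (\<lambda>x. {x}) ` (K \<inter> D)" for U
      using that D(2) by auto
    moreover have "K \<inter> D \<subseteq> \<Union>((\<lambda>x. {x}) ` (K \<inter> D))"
      by auto
    ultimately obtain \<F> where \<F>: "finite \<F>" "\<F> \<subseteq> (\<lambda>x. {x}) ` (K \<inter> D)" "K \<inter> D \<subseteq> \<Union>\<F>"
      using compactinD[of X "K \<inter> D" "(\<lambda>x. {x}) ` (K \<inter> D)"] by meson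
    then show ?thesis
      using finite_subset[OF \<F>(3) finite_Union] by auto
  qed
  define F where "F h = (\<lambda>x\<in>topspace X. if x \<in> D then h x else e x)" for h
  have F_in: "F h \<in> topspace (Ck2 X)" if h: "h \<in> topspace ?P" for h
  proof (rule Ck2_memI)
    show "F h \<in> extensional (topspace X)"
      by (simp add: F_def)
    have hv: "h x = 0 \<or> h x = 1" if "x \<in> D" for x
      using h that by (auto simp: PiE_iff)
    show "F h x = 0 \<or> F h x = 1" if "x \<in> topspace X" for x
      using that hv Ck2_values[OF e] by (auto simp: F_def)
    have "openin X {x \<in> topspace X. F h x = c}" for c
    proof -
      have "{x \<in> topspace X. F h x = c} =
          {x \<in> D. h x = c} \<union> ((topspace X - D) \<inter> {x \<in> topspace X. e x = c})"
        using D_sub by (auto simp: F_def)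
      moreover have "openin X {x \<in> D. h x = c}"
        by (rule sub_open) auto
      moreover have "openin X ((topspace X - D) \<inter> {x \<in> topspace X. e x = c})"
        using D(1) Ck2_fibre(1)[OF e] by (intro openin_Int) auto
      ultimately show ?thesis
        by (simp only: openin_Un)
    qed
    then show "openin X {x \<in> topspace X. F h x = 0}" "openin X {x \<in> topspace X. F h x = 1}"
      by auto
  qed
  have "continuous_map ?P (Ck2 X) F"
    unfolding continuous_map_def
  proof (intro conjI allI impI)
    show "F \<in> topspace ?P \<rightarrow> topspace (Ck2 X)"
      using F_in by auto
    fix U assume U: "openin (Ck2 X) U"
    show "openin ?P {h \<in> topspace ?P. F h \<in> U}"
    proof (subst openin_subopen, intro ballI)
      fix h assume h: "h \<in> {h \<in> topspace ?P. F h \<in> U}"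
      then obtain K where K: "compactin X K" "agreeing X (F h) K \<subseteq> U"
        using U unfolding openin_Ck2_iff by auto
      define V where "V = PiE D (\<lambda>x. if x \<in> K \<inter> D then {h x} else {0, 1 :: real})"
      have hD: "h \<in> PiE D (\<lambda>_. {0, 1})"
        using h by simp
      have "openin ?P V"
        unfolding V_def openin_PiE_gen
      proof (intro disjI2 conjI ballI)
        show "finite {i \<in> D. (if i \<in> K \<inter> D then {h i} else {0, 1}) \<noteq> topspace (discrete_topology {0, 1})}"
          by (rule finite_subset[OF _ fin[OF K(1)]]) auto
      qed (use hD in \<open>auto simp: PiE_iff\<close>)
      moreover have "h \<in> V"
        using hD by (auto simp: V_def PiE_iff)
      moreover have "V \<subseteq> {h \<in> topspace ?P. F h \<in> U}"
      proof
        fix h' assume h': "h' \<in> V"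
        have h'P: "h' \<in> topspace ?P"
          using h' hD by (auto simp: V_def PiE_iff split: if_splits) metis
        have "h' x = h x" if "x \<in> K \<inter> D" for x
          using h' that by (auto simp: V_def PiE_iff)
        then have "F h' x = F h x" if "x \<in> K" for x
          using that by (auto simp: F_def)
        then show "h' \<in> {h \<in> topspace ?P. F h \<in> U}"
          using F_in[OF h'P] h'P K(2) by (auto simp: agreeing_def)
      qed
      ultimately show "\<exists>T. openin ?P T \<and> h \<in> T \<and> T \<subseteq> {h \<in> topspace ?P. F h \<in> U}"
        by blast
    qed
  qed
  moreover have "compactin ?P (topspace ?P)"
    unfolding compact_space_def[symmetric] compact_space_product_topology
    by (simp add: compact_space_discrete_topology)
  ultimately have "compactin (Ck2 X) (F ` topspace ?P)"
    by (rule image_compactin[rotated])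
  moreover have "F ` topspace ?P = agreeing X e (topspace X - D)"
  proof (intro equalityI subsetI)
    fix g assume "g \<in> F ` topspace ?P"
    then show "g \<in> agreeing X e (topspace X - D)"
      using F_in by (auto simp: agreeing_def F_def)
  next
    fix g assume g: "g \<in> agreeing X e (topspace X - D)"
    then have gT: "g \<in> topspace (Ck2 X)"
      by (simp add: agreeing_def)
    have P: "restrict g D \<in> topspace ?P"
      using Ck2_values[OF gT] D_sub by (auto simp: PiE_iff)
    have "g = F (restrict g D)"
      by (rule Ck2_ext[OF gT F_in[OF P]]) (use g in \<open>auto simp: F_def agreeing_def\<close>)
    then show "g \<in> F ` topspace ?P"
      using P by blast
  qed
  ultimately show ?thesis
    by simp
qed

text \<open>All points off \<open>W n\<close> are isolated, so \<open>agreeing X e (W n)\<close> is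
  compact. Each function agrees on the non-isolated points with one of countably many
  \<open>e\<close>, hence also on some \<open>W n\<close>; thus countably many of these compact sets
  cover. That they determine the closed sets is shown by building, for \<open>f\<close> outside
  \<open>F\<close>, a compact set on which no member of \<open>F\<close> agrees with
  \<open>f\<close>.\<close>

lemma metrizable_compact_derived_imp_k_omega_Ck2:
  fixes X :: "'a topology"
  assumes X: "aleph0_space X" and m: "metrizable_space X"
    and X': "compactin X (non_isolated_points X)"
  shows "k_omega_space (Ck2 X)"
proof -
  let ?T = "topspace (Ck2 X)" and ?X' = "non_isolated_points X"
  obtain W :: "nat \<Rightarrow> 'a set" where "(\<forall>n. openin X (W n) \<and> ?X' \<subseteq> W n) \<and> (\<forall>m n. m \<le> n \<longrightarrow> W n \<subseteq> W m) \<and>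
      (\<forall>U. openin X U \<and> ?X' \<subseteq> U \<longrightarrow> (\<exists>n. W n \<subseteq> U))"
    using metrizable_compact_neighbourhood_base[OF m X'] by auto
  then have W: "\<And>n. openin X (W n)" "\<And>n. ?X' \<subseteq> W n" "\<And>m n. m \<le> n \<Longrightarrow> W n \<subseteq> W m"
    "\<And>U. openin X U \<Longrightarrow> ?X' \<subseteq> U \<Longrightarrow> \<exists>n. W n \<subseteq> U"
    by simp_all
  have W_sub: "W n \<subseteq> topspace X" for n
    using openin_subset[OF W(1)] .
  obtain \<E> where \<E>: "countable \<E>" "\<E> \<subseteq> ?T"
    "\<And>f. f \<in> ?T \<Longrightarrow> \<exists>e\<in>\<E>. \<forall>x\<in>?X'. f x = e x"
    using countable_restrictions_to_compact[OF X X'] by auto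
  have tail: "\<exists>n. \<forall>x\<in>W n. f x = e x" if "f \<in> ?T" "e \<in> ?T" "\<forall>x\<in>?X'. f x = e x" for f e
  proof -
    have "?X' \<subseteq> {x \<in> topspace X. f x = e x}"
      using that(3) by (auto simp: non_isolated_points_def)
    then have "\<exists>n. W n \<subseteq> {x \<in> topspace X. f x = e x}"
      using W(4) openin_Ck2_equalizer[OF that(1,2)] by simp
    then show ?thesis
      by auto
  qed
  define Z where "Z = (\<lambda>(e, n). agreeing X e (W n))"
  have Z_compact: "compactin (Ck2 X) (agreeing X e (W n))" if "e \<in> ?T" for e n
  proof -
    have "openin X {x}" if "x \<in> topspace X - W n" for x
      using that W(2)[of n] by (auto simp: non_isolated_points_def)
    then have "compactin (Ck2 X) (agreeing X e (topspace X - (topspace X - W n)))"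
      using W(1) that by (intro compactin_Ck2_vary_on_discrete) auto
    moreover have "topspace X - (topspace X - W n) = W n"
      using W_sub by auto
    ultimately show ?thesis
      by simp
  qed
  have closedI: "closedin (Ck2 X) F"
    if F: "F \<subseteq> ?T" and Fcl: "\<And>e n. e \<in> \<E> \<Longrightarrow> closedin (subtopology (Ck2 X) (agreeing X e (W n))) (F \<inter> agreeing X e (W n))"
    for F
  proof -
    have "\<exists>K. compactin X K \<and> agreeing X f K \<subseteq> ?T - F" if f: "f \<in> ?T - F" for f
    proof -
      obtain e where e: "e \<in> \<E>" "\<forall>x\<in>?X'. f x = e x"
        using \<E>(3) f by auto
      have eT: "e \<in> ?T"
        using e(1) \<E>(2) by auto
      obtain n0 where n0: "\<forall>x\<in>W n0. f x = e x"
        using tail[OF _ eT e(2)] f by auto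
      \<comment> \<open>The shift makes \<open>f\<close> itself a member of every compact set
        \<open>agreeing X e (V n)\<close>.\<close>
      define V where "V n = W (n0 + n)" for n
      have V_dec: "V n \<subseteq> V m" if "m \<le> n" for m n
        unfolding V_def using that by (intro W(3)) auto
      have fe: "f x = e x" if "x \<in> V n" for x n
        using n0 that V_dec[of 0 n] by (auto simp: V_def)
      have FZ: "compactin (Ck2 X) (F \<inter> agreeing X e (V n))" for n
        using closedin_compact_space[OF compact_space_subtopology[OF Z_compact[OF eT]] Fcl[OF e(1)], of "n0 + n"]
        by (simp add: compactin_subtopology V_def)
      \<comment> \<open>\<open>P n E\<close>: agreement with \<open>f\<close> on \<open>E\<close> excludes the part of \<open>F\<close> in the \<open>n\<close>-th compact set. Going
        from \<open>n\<close> to \<open>n + 1\<close>, by compactness finitely many new points of \<open>V n\<close> suffice, so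
        the union of the sets \<open>E\<close> accumulates only at the non-isolated points.\<close>
      define P where "P n E \<longleftrightarrow> finite E \<and> E \<subseteq> topspace X \<and>
          (\<forall>g \<in> F \<inter> agreeing X e (V n). \<exists>x\<in>E. g x \<noteq> f x)" for n E
      have base: "\<exists>E. P 0 E"
      proof (rule ccontr)
        assume no: "\<not> ?thesis"
        have "\<exists>g\<in>F \<inter> agreeing X e (V 0). \<forall>x\<in>topspace X. g x = f x"
        proof (rule compactin_Ck2_pointwise[OF FZ subset_refl])
          fix E assume "finite E" "E \<subseteq> topspace X"
          then show "\<exists>g\<in>F \<inter> agreeing X e (V 0). \<forall>x\<in>E. g x = f x"
            using no unfolding P_def by auto
        qed
        then obtain g where "g \<in> F" "\<forall>x\<in>topspace X. g x = f x"
          by auto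
        then have "g = f"
          using Ck2_ext[of g X f] F f by auto
        then show False
          using \<open>g \<in> F\<close> f by simp
      qed
      have step: "\<exists>E'. P (Suc n) E' \<and> E \<subseteq> E' \<and> E' - E \<subseteq> V n" if E: "P n E" for n E
      proof (rule ccontr)
        assume no: "\<not> ?thesis"
        have E': "finite E" "E \<subseteq> topspace X" "\<And>g. g \<in> F \<Longrightarrow> g \<in> agreeing X e (V n) \<Longrightarrow> \<exists>x\<in>E. g x \<noteq> f x"
          using E unfolding P_def by auto
        let ?Q = "F \<inter> agreeing X e (V (Suc n)) \<inter> agreeing X f E"
        have "compactin (Ck2 X) ?Q"
          using FZ agreeing_clopen(2)[OF finite_imp_compactin[OF E'(2,1)]] by (rule compact_Int_closedin)
        moreover have "V n \<subseteq> topspace X"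
          unfolding V_def by (rule W_sub)
        \<comment> \<open>If no finite set of new points works, pointwise compactness yields one
          \<open>g\<close> in \<open>F\<close> equal to \<open>f\<close>, hence to \<open>e\<close>,
          on all of \<open>V n\<close>. Then \<open>g\<close> lies in the earlier compact set and
          disagrees with \<open>f\<close> on \<open>E\<close>, although it was taken to agree
          there.\<close>
        ultimately have "\<exists>g\<in>?Q. \<forall>x\<in>V n. g x = f x"
        proof (rule compactin_Ck2_pointwise)
          fix A assume A: "finite A" "A \<subseteq> V n"
          then have "\<not> P (Suc n) (E \<union> A)"
            using no by blast
          then obtain g where g: "g \<in> F \<inter> agreeing X e (V (Suc n))" "\<forall>x\<in>E \<union> A. g x = f x"
            using E'(1,2) A \<open>V n \<subseteq> topspace X\<close> unfolding P_def by auto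
          then show "\<exists>g\<in>?Q. \<forall>x\<in>A. g x = f x"
            by (intro bexI[of _ g]) (auto simp: agreeing_def)
        qed
        then obtain g where g: "g \<in> F" "g \<in> agreeing X f E" "\<forall>x\<in>V n. g x = f x"
          by auto
        then have "g \<in> agreeing X e (V n)"
          using fe F by (auto simp: agreeing_def)
        then show False
          using E'(3)[OF g(1)] g(2) by (auto simp: agreeing_def)
      qed
      obtain E where E: "\<And>n. P n (E n)" "\<And>n. E n \<subseteq> E (Suc n)" "\<And>n. E (Suc n) - E n \<subseteq> V n"
        using dependent_nat_choice[of P "\<lambda>n E E'. E \<subseteq> E' \<and> E' - E \<subseteq> V n"] base step by metis
      \<comment> \<open>Points added from stage \<open>n\<close> on lie in \<open>V n\<close>. Hence
        each neighbourhood of the non-isolated points contains all but finitely many points of the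
        union.\<close>
      have E_tail: "E m \<subseteq> E n \<union> V n" for m n
      proof (induction m)
        case 0
        have "E 0 \<subseteq> E n"
          using E(2) by (rule lift_Suc_mono_le) simp
        then show ?case
          by auto
      next
        case (Suc m)
        show ?case
        proof (cases "n \<le> m")
          case True
          have "E (Suc m) \<subseteq> E m \<union> V m"
            using E(3)[of m] by auto
          also have "\<dots> \<subseteq> E n \<union> V n"
            by (rule Un_least[OF Suc.IH le_supI2[OF V_dec[OF True]]])
          finally show ?thesis .
        next
          case False
          then have "Suc m \<le> n"
            by simp
          with E(2) have "E (Suc m) \<subseteq> E n"
            by (rule lift_Suc_mono_le)
          then show ?thesis
            by auto
        qed
      qed
      have "compactin X (?X' \<union> (\<Union>n. E n))"
      proof (rule compactin_Un_almost_covered[OF X'])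
        show "(\<Union>n. E n) \<subseteq> topspace X"
          using E(1) unfolding P_def by auto
        fix U assume "openin X U" "?X' \<subseteq> U"
        then obtain k where k: "W k \<subseteq> U"
          using W(4)[of U] by auto
        have "V k \<subseteq> W k"
          unfolding V_def by (intro W(3)) simp
        then have "(\<Union>n. E n) - U \<subseteq> E k"
          using E_tail[of _ k] k by auto
        then show "finite ((\<Union>n. E n) - U)"
          using E(1)[of k] finite_subset unfolding P_def by auto
      qed
      moreover have "agreeing X f (?X' \<union> (\<Union>n. E n)) \<subseteq> ?T - F"
      proof
        fix g assume g: "g \<in> agreeing X f (?X' \<union> (\<Union>n. E n))"
        then have gT: "g \<in> ?T"
          by (simp add: agreeing_def)
        obtain k where k: "\<forall>x\<in>W k. g x = e x"
          using tail[OF gT eT] g e(2) by (auto simp: agreeing_def)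
        have "V k \<subseteq> W k"
          unfolding V_def by (intro W(3)) simp
        then have "g \<in> agreeing X e (V k)"
          using k gT by (auto simp: agreeing_def)
        moreover have "g x = f x" if "x \<in> E k" for x
          using g that by (auto simp: agreeing_def)
        ultimately have "g \<notin> F"
          using E(1)[of k] unfolding P_def by (metis IntI)
        then show "g \<in> ?T - F"
          using gT by simp
      qed
      ultimately show ?thesis
        by (intro exI conjI)
    qed
    then have "openin (Ck2 X) (?T - F)"
      unfolding openin_Ck2_iff by simp
    then show ?thesis
      using F by (simp add: closedin_def)
  qed
  have closedD: "closedin (subtopology (Ck2 X) S) (F \<inter> S)" if "closedin (Ck2 X) F" for F S
    using closedin_subtopology_Int_closed[OF that, of S] by (simp add: Int_commute)
  have cover: "\<Union>(Z ` (\<E> \<times> UNIV)) = ?T"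
  proof
    show "\<Union>(Z ` (\<E> \<times> UNIV)) \<subseteq> ?T"
      by (auto simp: Z_def agreeing_def)
    show "?T \<subseteq> \<Union>(Z ` (\<E> \<times> UNIV))"
    proof
      fix f assume f: "f \<in> ?T"
      then obtain e where e: "e \<in> \<E>" "\<forall>x\<in>?X'. f x = e x"
        using \<E>(3) by auto
      then obtain n where "\<forall>x\<in>W n. f x = e x"
        using tail[OF f subsetD[OF \<E>(2) e(1)] e(2)] by auto
      then have "f \<in> Z (e, n)"
        using f by (simp add: Z_def agreeing_def)
      then show "f \<in> \<Union>(Z ` (\<E> \<times> UNIV))"
        using e(1) by blast
    qed
  qed
  have ctble: "countable (Z ` (\<E> \<times> (UNIV :: nat set)))"
    using \<E>(1) by (intro countable_image countable_SIGMA) auto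
  have cpt: "compactin (Ck2 X) S" if "S \<in> Z ` (\<E> \<times> UNIV)" for S
    using that Z_compact \<E>(2) by (auto simp: Z_def)
  show ?thesis
    unfolding k_omega_space_def
  proof (rule exI[of _ "Z ` (\<E> \<times> UNIV)"], intro conjI ballI allI impI ctble cpt cover)
    fix F assume F: "F \<subseteq> ?T"
    show "closedin (Ck2 X) F \<longleftrightarrow> (\<forall>K\<in>Z ` (\<E> \<times> UNIV). closedin (subtopology (Ck2 X) K) (F \<inter> K))"
    proof
      assume "\<forall>K\<in>Z ` (\<E> \<times> UNIV). closedin (subtopology (Ck2 X) K) (F \<inter> K)"
      then show "closedin (Ck2 X) F"
        by (intro closedI[OF F]) (auto simp: Z_def)
    qed (use closedD in auto)
  qed
qed


section \<open>Strong fans\<close>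

lemma zero_dimensional_compact_clopen_between:
  assumes zd: "zero_dimensional_space X" and K: "compactin X K" and U: "openin X U" "K \<subseteq> U"
  shows "\<exists>B. openin X B \<and> closedin X B \<and> K \<subseteq> B \<and> B \<subseteq> U"
proof -
  let ?\<B> = "{B. openin X B \<and> closedin X B \<and> B \<subseteq> U}"
  have "K \<subseteq> \<Union>?\<B>"
  proof
    fix x assume "x \<in> K"
    then have "x \<in> U"
      using U(2) by auto
    then obtain B where "openin X B" "closedin X B" "x \<in> B" "B \<subseteq> U"
      using zd U(1) unfolding zero_dimensional_space_def by metis
    then show "x \<in> \<Union>?\<B>"
      by auto
  qed
  then obtain \<F> where \<F>: "finite \<F>" "\<F> \<subseteq> ?\<B>" "K \<subseteq> \<Union>\<F>"
    using compactinD[OF K, of ?\<B>] by auto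
  then have "openin X (\<Union>\<F>)" "closedin X (\<Union>\<F>)" "\<Union>\<F> \<subseteq> U"
    by (auto intro!: openin_Union closedin_Union)
  then show ?thesis
    using \<F>(3) by (intro exI[of _ "\<Union>\<F>"]) simp
qed

text \<open>Members are closures of finite unions from the given \<open>k\<close>-network. A clopen
  set inserted between \<open>K\<close> and \<open>U\<close> keeps the closure inside
  \<open>U\<close>.\<close>

lemma closed_k_network:
  assumes zd: "zero_dimensional_space X" and X: "aleph0_space X"
  shows "\<exists>\<N>. countable \<N> \<and> (\<forall>N\<in>\<N>. closedin X N) \<and> (\<forall>M\<in>\<N>. \<forall>N\<in>\<N>. M \<union> N \<in> \<N>) \<and>
    (\<forall>K U. compactin X K \<and> openin X U \<and> K \<subseteq> U \<longrightarrow> (\<exists>N\<in>\<N>. K \<subseteq> N \<and> N \<subseteq> U))"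
proof -
  obtain \<N> where \<N>: "countable \<N>" "k_network_in X \<N>"
    using X unfolding aleph0_space_def by auto
  define \<M> where "\<M> = (\<lambda>\<F>. X closure_of \<Union>\<F>) ` {\<F>. finite \<F> \<and> \<F> \<subseteq> \<N>}"
  have "countable \<M>"
    unfolding \<M>_def using \<N>(1) by (intro countable_image countable_Collect_finite_subset)
  moreover have "\<forall>N\<in>\<M>. closedin X N"
    unfolding \<M>_def by auto
  moreover have "M \<union> N \<in> \<M>" if MN: "M \<in> \<M>" "N \<in> \<M>" for M N
  proof -
    obtain \<F> \<G> where "M = X closure_of \<Union>\<F>" "finite \<F>" "\<F> \<subseteq> \<N>"
      "N = X closure_of \<Union>\<G>" "finite \<G>" "\<G> \<subseteq> \<N>"
      using MN unfolding \<M>_def by auto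
    then show ?thesis
      unfolding \<M>_def by (intro image_eqI[of _ _ "\<F> \<union> \<G>"]) (auto simp: closure_of_Un)
  qed
  moreover have "\<exists>N\<in>\<M>. K \<subseteq> N \<and> N \<subseteq> U" if KU: "compactin X K" "openin X U" "K \<subseteq> U" for K U
  proof -
    obtain B where B: "openin X B" "closedin X B" "K \<subseteq> B" "B \<subseteq> U"
      using zero_dimensional_compact_clopen_between[OF zd KU] by auto
    obtain \<F> where \<F>: "finite \<F>" "\<F> \<subseteq> \<N>" "K \<subseteq> \<Union>\<F>" "\<Union>\<F> \<subseteq> B"
      using \<N>(2) B(1,3) KU(1) unfolding k_network_in_def by meson
    have "\<Union>\<F> \<subseteq> topspace X"
      using \<F>(4) openin_subset[OF B(1)] by (rule order_trans)
    then have "K \<subseteq> X closure_of \<Union>\<F>"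
      using \<F>(3) closure_of_subset order_trans by metis
    moreover have "X closure_of \<Union>\<F> \<subseteq> U"
      using closure_of_minimal[OF \<F>(4) B(2)] B(4) by (rule order_trans)
    ultimately show ?thesis
      using \<F>(1,2) unfolding \<M>_def by (intro bexI[of _ "X closure_of \<Union>\<F>"]) auto
  qed
  ultimately show ?thesis
    by (intro exI[of _ \<M>]) simp
qed

text \<open>The functions vanishing on \<open>N\<close> are pointwise dense in all \<open>{0,1}\<close>-valued functions vanishing
  on \<open>N\<close>; if they form a compact set, every such function is continuous.\<close>

lemma compact_vanishing_imp_clopen:
  assumes zd: "zero_dimensional_space X" and t1: "t1_space X" and N: "closedin X N"
    and cpt: "compactin (Ck2 X) {g \<in> topspace (Ck2 X). \<forall>x\<in>N. g x = 0}"
    and S: "S \<subseteq> topspace X - N"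
  shows "openin X S" "closedin X S"
proof -
  let ?Q = "{g \<in> topspace (Ck2 X). \<forall>x\<in>N. g x = 0}"
  have "\<exists>g\<in>?Q. \<forall>x\<in>topspace X. g x = (if x \<in> S then 1 else 0)"
  proof (rule compactin_Ck2_pointwise[OF cpt subset_refl])
    fix E assume E: "finite E" "E \<subseteq> topspace X"
    have "closedin X (E - S)"
      using t1 E unfolding t1_space_closedin_finite by auto
    then have "openin X (topspace X - (N \<union> (E - S)))"
      using N by (intro openin_diff openin_topspace closedin_Un)
    moreover have "compactin X (E \<inter> S)"
      using E by (intro finite_imp_compactin) auto
    moreover have "E \<inter> S \<subseteq> topspace X - (N \<union> (E - S))"
      using S by auto
    ultimately obtain B where B: "openin X B" "closedin X B" "E \<inter> S \<subseteq> B"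
      "B \<subseteq> topspace X - (N \<union> (E - S))"
      using zero_dimensional_compact_clopen_between[OF zd] by metis
    have "char_fun X B \<in> ?Q"
      using char_fun_in_Ck2[OF B(1,2)] B(4) closedin_subset[OF N] by (auto simp: char_fun_def)
    moreover have "char_fun X B x = (if x \<in> S then 1 else 0)" if "x \<in> E" for x
      using that B(3,4) E(2) by (auto simp: char_fun_def)
    ultimately show "\<exists>g\<in>?Q. \<forall>x\<in>E. g x = (if x \<in> S then 1 else 0)"
      by auto
  qed
  then obtain g where g: "g \<in> topspace (Ck2 X)" "\<forall>x\<in>topspace X. g x = (if x \<in> S then 1 else 0)"
    by auto
  have "S = {x \<in> topspace X. g x = 1}"
    using g(2) S by (auto split: if_splits)
  then show "openin X S" "closedin X S"
    using Ck2_fibre[OF g(1), of 1] by simp_all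
qed

text \<open>The separating maps are the membership predicates of the basic sets; sets on which
  finitely many of them are constant are open because the basic sets are clopen.\<close>

lemma countable_clopen_base_imp_metrizable:
  assumes t1: "t1_space X" and ctble: "countable \<O>"
    and clopen: "\<And>B. B \<in> \<O> \<Longrightarrow> openin X B" "\<And>B. B \<in> \<O> \<Longrightarrow> closedin X B"
    and base: "\<And>U x. openin X U \<Longrightarrow> x \<in> U \<Longrightarrow> \<exists>B\<in>\<O>. x \<in> B \<and> B \<subseteq> U"
  shows "metrizable_space X"
proof -
  \<comment> \<open>The added empty set lets the enumeration exist even when the base is
    empty.\<close>
  define B where "B n = from_nat_into (insert {} \<O>) n" for n
  have B_in: "B n \<in> insert {} \<O>" for n
    unfolding B_def by (rule from_nat_into) simp
  have B: "openin X (B n)" "closedin X (B n)" for n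
    using B_in[of n] clopen by auto
  have B_surj: "\<exists>n. B n = C" if "C \<in> \<O>" for C
    unfolding B_def using from_nat_into_surj[of "insert {} \<O>" C] ctble that by auto
  show ?thesis
  proof (rule metrizable_spaceI_separating_maps[where \<phi> = "\<lambda>n x. x \<in> B n"])
    fix x y assume xy: "x \<in> topspace X" "y \<in> topspace X" "\<And>n. (x \<in> B n) = (y \<in> B n)"
    show "x = y"
    proof (rule ccontr)
      assume "x \<noteq> y"
      then obtain U where "openin X U" "x \<in> U" "y \<notin> U"
        using t1 xy(1,2) unfolding t1_space_def by metis
      then obtain n where "x \<in> B n" "B n \<subseteq> U"
        using base B_surj by metis
      then show False
        using xy(3)[of n] \<open>y \<notin> U\<close> by auto
    qed
  next
    fix U
    have loc: "openin X {y \<in> topspace X. \<forall>i<n. (y \<in> B i) = (x \<in> B i)}" for n x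
    proof -
      define C where "C i = {y \<in> topspace X. (y \<in> B i) = (x \<in> B i)}" for i
      have "C i = (if x \<in> B i then B i else topspace X - B i)" for i
        using openin_subset[OF B(1)[of i]] by (auto simp: C_def)
      then have C: "openin X (C i)" for i
        using B[of i] by auto
      have "openin X (topspace X \<inter> \<Inter>(C ` {..<n}))"
      proof (cases "n = 0")
        case False
        then have "openin X (\<Inter>(C ` {..<n}))"
          using C by (intro openin_Inter) auto
        then show ?thesis
          by (intro openin_Int openin_topspace)
      qed simp
      moreover have "{y \<in> topspace X. \<forall>i<n. (y \<in> B i) = (x \<in> B i)} = topspace X \<inter> \<Inter>(C ` {..<n})"
        by (auto simp: C_def)
      ultimately show ?thesis
        by simp
    qed
    show "openin X U \<longleftrightarrow> U \<subseteq> topspace X \<and>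
        (\<forall>x\<in>U. \<exists>n. {y \<in> topspace X. \<forall>i<n. (y \<in> B i) = (x \<in> B i)} \<subseteq> U)"
    proof (intro iffI conjI ballI)
      fix x assume "openin X U" "x \<in> U"
      then obtain n where n: "x \<in> B n" "B n \<subseteq> U"
        using base B_surj by metis
      have "{y \<in> topspace X. \<forall>i<Suc n. (y \<in> B i) = (x \<in> B i)} \<subseteq> B n"
        using n(1) by auto
      then show "\<exists>n. {y \<in> topspace X. \<forall>i<n. (y \<in> B i) = (x \<in> B i)} \<subseteq> U"
        using n(2) by (intro exI[of _ "Suc n"]) (rule order_trans)
    next
      assume R: "U \<subseteq> topspace X \<and>
        (\<forall>x\<in>U. \<exists>n. {y \<in> topspace X. \<forall>i<n. (y \<in> B i) = (x \<in> B i)} \<subseteq> U)"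
      show "openin X U"
      proof (subst openin_subopen, intro ballI)
        fix x assume x: "x \<in> U"
        then obtain n where n: "{y \<in> topspace X. \<forall>i<n. (y \<in> B i) = (x \<in> B i)} \<subseteq> U"
          using R by auto
        then show "\<exists>T. openin X T \<and> x \<in> T \<and> T \<subseteq> U"
          using loc[of n x] x R
          by (intro exI[of _ "{y \<in> topspace X. \<forall>i<n. (y \<in> B i) = (x \<in> B i)}"]) auto
      qed
    qed (rule openin_subset)
  qed
qed

text \<open>If \<open>N\<close> contains \<open>K\<close>, all subsets of its complement are clopen;
  so \<open>N\<close> is open and every point off \<open>N\<close> is isolated. Shrinking
  \<open>N\<close> towards \<open>K\<close> isolates every point off \<open>K\<close>. The open
  members of \<N> turn out to be a countable clopen base.\<close>

lemma compact_vanishing_imp_metrizable: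
  assumes zd: "zero_dimensional_space X" and t1: "t1_space X"
    and ctble: "countable \<N>" and closed: "\<And>N. N \<in> \<N> \<Longrightarrow> closedin X N"
    and un: "\<And>M N. M \<in> \<N> \<Longrightarrow> N \<in> \<N> \<Longrightarrow> M \<union> N \<in> \<N>"
    and net: "\<And>K U. compactin X K \<Longrightarrow> openin X U \<Longrightarrow> K \<subseteq> U \<Longrightarrow> \<exists>N\<in>\<N>. K \<subseteq> N \<and> N \<subseteq> U"
    and K: "compactin X K"
    and cpt: "\<And>N. N \<in> \<N> \<Longrightarrow> K \<subseteq> N \<Longrightarrow>
      compactin (Ck2 X) {g \<in> topspace (Ck2 X). \<forall>x\<in>N. g x = 0}"
  shows "metrizable_space X" "compactin X (non_isolated_points X)"
proof -
  have op: "openin X N" if "N \<in> \<N>" "K \<subseteq> N" for N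
  proof -
    have "closedin X (topspace X - N)"
      using compact_vanishing_imp_clopen(2)[OF zd t1 closed[OF that(1)] cpt[OF that]] by simp
    then show ?thesis
      using closedin_subset[OF closed[OF that(1)]] by (simp add: openin_closedin_eq)
  qed
  have iso: "openin X {x}" if x: "x \<in> topspace X - K" for x
  proof -
    have "openin X (topspace X - {x})"
      using t1 x by (intro openin_diff openin_topspace) (simp add: closedin_t1_singleton)
    moreover have "K \<subseteq> topspace X - {x}"
      using x compactin_subset_topspace[OF K] by auto
    ultimately obtain N where N: "N \<in> \<N>" "K \<subseteq> N" "N \<subseteq> topspace X - {x}"
      using net[OF K] by metis
    show ?thesis
      using x N(3) by (intro compact_vanishing_imp_clopen(1)[OF zd t1 closed[OF N(1)] cpt[OF N(1,2)]]) auto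
  qed
  have "openin X (\<Union>{{x} |x. openin X {x}})"
    by (intro openin_Union) auto
  moreover have "x \<in> topspace X" if "openin X {x}" for x
    using openin_subset[OF that] by simp
  then have "topspace X - non_isolated_points X = \<Union>{{x} |x. openin X {x}}"
    by (auto simp: non_isolated_points_def)
  ultimately have "closedin X (non_isolated_points X)"
    by (auto simp: closedin_def non_isolated_points_def)
  then have "compactin X (K \<inter> non_isolated_points X)"
    using K by (intro compact_Int_closedin)
  moreover have "K \<inter> non_isolated_points X = non_isolated_points X"
    using iso by (auto simp: non_isolated_points_def)
  ultimately show "compactin X (non_isolated_points X)"
    by simp
  have base: "\<exists>N\<in>{N \<in> \<N>. openin X N}. x \<in> N \<and> N \<subseteq> U" if U: "openin X U" "x \<in> U" for U x
  proof -
    obtain B where B: "openin X B" "closedin X B" "x \<in> B" "B \<subseteq> U"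
      using zd U unfolding zero_dimensional_space_def by metis
    \<comment> \<open>The point \<open>x\<close> is added because it may lie off
      \<open>K\<close>.\<close>
    have "compactin X ((K \<inter> B) \<union> {x})"
      using K B openin_subset[OF B(1)] by (intro compactin_Un compact_Int_closedin) auto
    moreover have "(K \<inter> B) \<union> {x} \<subseteq> B"
      using B(3) by auto
    ultimately obtain N where N: "N \<in> \<N>" "(K \<inter> B) \<union> {x} \<subseteq> N" "N \<subseteq> B"
      using net B(1) by metis
    have "compactin X (K \<inter> (topspace X - B))"
      using K B(1) by (intro compact_Int_closedin closedin_diff closedin_topspace)
    moreover have "K \<inter> (topspace X - B) \<subseteq> topspace X - B"
      by auto
    moreover have "openin X (topspace X - B)"
      using B(2) by (intro openin_diff openin_topspace)
    ultimately obtain N' where N': "N' \<in> \<N>" "K \<inter> (topspace X - B) \<subseteq> N'" "N' \<subseteq> topspace X - B"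
      using net by metis
    \<comment> \<open>\<open>N \<union> N'\<close> contains \<open>K\<close>, so it is open, and \<open>B\<close> cuts \<open>N\<close> out of it.\<close>
    have "K \<subseteq> N \<union> N'"
      using N(2) N'(2) compactin_subset_topspace[OF K] by auto
    then have "openin X ((N \<union> N') \<inter> B)"
      using op[OF un[OF N(1) N'(1)]] B(1) by (intro openin_Int)
    moreover have "(N \<union> N') \<inter> B = N"
      using N(3) N'(3) by auto
    ultimately show ?thesis
      using N B(4) by (intro bexI[of _ N]) auto
  qed
  show "metrizable_space X"
    using ctble by (intro countable_clopen_base_imp_metrizable[OF t1 _ _ _ base]) (auto intro: closed)
qed

text \<open>If every compact set lay in a compact finite intersection of members of \<N>, these
  countably many intersections would witness hemicompactness. So for some \<open>K\<close> no such
  intersection containing \<open>K\<close> is compact, and the initial intersections in an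
  enumeration of the members containing \<open>K\<close> shrink to \<open>K\<close>.\<close>

lemma not_hemicompact_noncompact_sequence:
  fixes X :: "'a topology"
  assumes nh: "\<not> hemicompact_space X"
    and ctble: "countable \<N>" and closed: "\<And>N. N \<in> \<N> \<Longrightarrow> closedin X N"
    and net: "\<And>K U. compactin X K \<Longrightarrow> openin X U \<Longrightarrow> K \<subseteq> U \<Longrightarrow> \<exists>N\<in>\<N>. K \<subseteq> N \<and> N \<subseteq> U"
  shows "\<exists>K (A :: nat \<Rightarrow> 'a set). compactin X K \<and> (\<forall>m. closedin X (A m) \<and> \<not> compactin X (A m)) \<and>
    (\<forall>U. openin X U \<and> K \<subseteq> U \<longrightarrow> (\<exists>j. \<forall>m\<ge>j. A m \<subseteq> U))"
proof -
  \<comment> \<open>The empty family is excluded because its intersection would be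
    \<open>UNIV\<close>.\<close>
  define \<D> where "\<D> = \<Inter> ` ({\<F>. finite \<F> \<and> \<F> \<subseteq> \<N>} \<inter> {\<F>. \<F> \<noteq> {}})"
  have "countable \<D>"
    unfolding \<D>_def by (intro countable_image countable_Int1 countable_Collect_finite_subset ctble)
  have "\<exists>K. compactin X K \<and> (\<forall>D\<in>\<D>. K \<subseteq> D \<longrightarrow> \<not> compactin X D)"
  proof (rule ccontr)
    assume "\<not> ?thesis"
    then have *: "\<exists>D\<in>\<D>. K \<subseteq> D \<and> compactin X D" if "compactin X K" for K
      using that by auto
    have "topspace X \<subseteq> \<Union>{D \<in> \<D>. compactin X D}"
    proof
      fix x assume "x \<in> topspace X"
      then show "x \<in> \<Union>{D \<in> \<D>. compactin X D}"
        using *[of "{x}"] by auto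
    qed
    then have "\<Union>{D \<in> \<D>. compactin X D} = topspace X"
      using compactin_subset_topspace by blast
    moreover have "\<exists>D\<in>{D \<in> \<D>. compactin X D}. C \<subseteq> D" if "compactin X C" for C
      using *[OF that] by auto
    ultimately have "hemicompact_space X"
      unfolding hemicompact_space_def using \<open>countable \<D>\<close>
      by (intro exI[of _ "{D \<in> \<D>. compactin X D}"]) simp
    then show False
      using nh by simp
  qed
  then obtain K where K: "compactin X K" "\<And>D. D \<in> \<D> \<Longrightarrow> K \<subseteq> D \<Longrightarrow> \<not> compactin X D"
    by auto
  define \<M> where "\<M> = {N \<in> \<N>. K \<subseteq> N}"
  have "countable \<M>"
    unfolding \<M>_def using ctble by simp
  have "\<M> \<noteq> {}"
    using net[OF K(1) openin_topspace compactin_subset_topspace[OF K(1)]] by (auto simp: \<M>_def)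
  define A where "A m = \<Inter>(from_nat_into \<M> ` {..m})" for m
  have M: "from_nat_into \<M> i \<in> \<N>" "K \<subseteq> from_nat_into \<M> i" for i
    using from_nat_into[OF \<open>\<M> \<noteq> {}\<close>, of i] by (auto simp: \<M>_def)
  have "closedin X (A m)" for m
    unfolding A_def using closed[OF M(1)] by (intro closedin_Inter) auto
  moreover have "\<not> compactin X (A m)" for m
  proof (rule K(2))
    show "A m \<in> \<D>"
      unfolding A_def \<D>_def using M(1) by (intro image_eqI[OF refl]) auto
    show "K \<subseteq> A m"
      unfolding A_def using M(2) by auto
  qed
  moreover have "\<exists>j. \<forall>m\<ge>j. A m \<subseteq> U" if U: "openin X U" "K \<subseteq> U" for U
  proof -
    obtain N where N: "N \<in> \<M>" "N \<subseteq> U"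
      using net[OF K(1) U] by (auto simp: \<M>_def)
    then obtain j where "from_nat_into \<M> j = N"
      using from_nat_into_surj[OF \<open>countable \<M>\<close> N(1)] by auto
    then have "A m \<subseteq> U" if "m \<ge> j" for m
      using N(2) that unfolding A_def by auto
    then show ?thesis
      by auto
  qed
  ultimately show ?thesis
    using K(1) by (intro exI[of _ K] exI[of _ A]) simp
qed

text \<open>This is pointwise addition modulo 2, the group operation on \<open>Ck2 X\<close>; adding
  a fixed function is a continuous involution.\<close>

definition symdiff_fun :: "'a topology \<Rightarrow> ('a \<Rightarrow> real) \<Rightarrow> ('a \<Rightarrow> real) \<Rightarrow> 'a \<Rightarrow> real" where
  "symdiff_fun X f g = char_fun X {x \<in> topspace X. f x \<noteq> g x}"

lemma symdiff_fun_apply: "x \<in> topspace X \<Longrightarrow> symdiff_fun X f g x = (if f x = g x then 0 else 1)"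
  by (simp add: symdiff_fun_def char_fun_def)

lemma symdiff_fun_in_Ck2:
  assumes f: "f \<in> topspace (Ck2 X)" and g: "g \<in> topspace (Ck2 X)"
  shows "symdiff_fun X f g \<in> topspace (Ck2 X)"
  unfolding symdiff_fun_def
proof (rule char_fun_in_Ck2)
  have "{x \<in> topspace X. f x \<noteq> g x} =
      ({x \<in> topspace X. f x = 0} \<inter> {x \<in> topspace X. g x = 1}) \<union>
      ({x \<in> topspace X. f x = 1} \<inter> {x \<in> topspace X. g x = 0})"
    using Ck2_values[OF f] Ck2_values[OF g] by fastforce
  then show "openin X {x \<in> topspace X. f x \<noteq> g x}" "closedin X {x \<in> topspace X. f x \<noteq> g x}"
    using Ck2_fibre[OF f] Ck2_fibre[OF g]
    by (simp_all add: openin_Int openin_Un closedin_Int closedin_Un)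
qed

lemma symdiff_fun_cancel:
  assumes f: "f \<in> topspace (Ck2 X)" and g: "g \<in> topspace (Ck2 X)"
  shows "symdiff_fun X (symdiff_fun X f g) g = f"
proof (rule Ck2_ext)
  fix x assume "x \<in> topspace X"
  then show "symdiff_fun X (symdiff_fun X f g) g x = f x"
    using Ck2_values[OF f, of x] Ck2_values[OF g, of x] by (auto simp: symdiff_fun_apply)
qed (intro symdiff_fun_in_Ck2 f g)+

lemma continuous_map_symdiff_fun:
  assumes c: "c \<in> topspace (Ck2 X)"
  shows "continuous_map (Ck2 X) (Ck2 X) (\<lambda>g. symdiff_fun X g c)"
  unfolding continuous_map_def
proof (intro conjI allI impI)
  show "(\<lambda>g. symdiff_fun X g c) \<in> topspace (Ck2 X) \<rightarrow> topspace (Ck2 X)"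
    using symdiff_fun_in_Ck2[OF _ c] by auto
  fix U assume U: "openin (Ck2 X) U"
  show "openin (Ck2 X) {g \<in> topspace (Ck2 X). symdiff_fun X g c \<in> U}"
    unfolding openin_Ck2_iff
  proof (intro conjI ballI)
    fix g assume "g \<in> {g \<in> topspace (Ck2 X). symdiff_fun X g c \<in> U}"
    then obtain K where K: "compactin X K" "agreeing X (symdiff_fun X g c) K \<subseteq> U"
      using U unfolding openin_Ck2_iff by auto
    have "symdiff_fun X h c \<in> agreeing X (symdiff_fun X g c) K" if "h \<in> agreeing X g K" for h
      using that symdiff_fun_in_Ck2[OF _ c, of h] compactin_subset_topspace[OF K(1)]
      by (auto simp: agreeing_def symdiff_fun_apply subset_iff)
    then show "\<exists>K. compactin X K \<and> agreeing X g K \<subseteq> {g \<in> topspace (Ck2 X). symdiff_fun X g c \<in> U}"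
      using K by (intro exI[of _ K]) (auto simp: agreeing_def)
  qed auto
qed

lemma locally_finite_family_shift:
  assumes "locally_finite_family Y F"
  shows "locally_finite_family Y (\<lambda>k. F (k + s))"
proof -
  have "finite {k. F (k + s) \<inter> V \<noteq> {}}" if "finite {n. F n \<inter> V \<noteq> {}}" for V
  proof -
    have "{k. F (k + s) \<inter> V \<noteq> {}} = (\<lambda>k. k + s) -` {n. F n \<inter> V \<noteq> {}}"
      by auto
    then show ?thesis
      using finite_vimageI[OF that, of "\<lambda>k. k + s"] by (simp add: inj_on_def)
  qed
  then show ?thesis
    using assms unfolding locally_finite_family_def by meson
qed

text \<open>A locally finite sequence has only finitely many members meeting the compact set
  \<open>K\<close>; an index shift drops them.\<close>

lemma zero_dimensional_noncompact_partition_off: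
  fixes X :: "'a topology"
  assumes "zero_dimensional_space X" "countable \<N>" "network_in X \<N>"
    "closedin X N" "\<not> compactin X N" and K: "compactin X K"
  shows "\<exists>P :: nat \<Rightarrow> 'a set. (\<forall>k. openin X (P k) \<and> closedin X (P k) \<and> P k \<inter> N \<noteq> {} \<and> P k \<inter> K = {}) \<and>
      locally_finite_family X P"
proof -
  obtain P :: "nat \<Rightarrow> 'a set" where P: "\<And>k. openin X (P k)" "\<And>k. closedin X (P k)"
    "\<And>k. P k \<inter> N \<noteq> {}" "locally_finite_family X P"
    using zero_dimensional_noncompact_partition[OF assms(1-5)] by auto
  have "finite {k. P k \<inter> K \<noteq> {}}"
    using locally_finite_imp_compact_finite[OF P(4)] K by (simp add: compact_finite_family_def)
  then obtain s where s: "\<forall>k\<in>{k. P k \<inter> K \<noteq> {}}. k < s"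
    using finite_nat_set_iff_bounded by auto
  have "P (k + s) \<inter> K = {}" for k
    using s by force
  then show ?thesis
    using P locally_finite_family_shift[OF P(4), of s] by (intro exI[of _ "\<lambda>k. P (k + s)"]) simp
qed

text \<open>Vanishing on \<open>N\<close> is an intersection of conditions at single points, each
  closed because a one-point set is compact.\<close>

lemma closedin_Ck2_vanishing:
  assumes "N \<subseteq> topspace X"
  shows "closedin (Ck2 X) {g \<in> topspace (Ck2 X). \<forall>x\<in>N. g x = 0}"
proof -
  have "closedin (Ck2 X) (topspace (Ck2 X) \<inter> \<Inter>((\<lambda>x. agreeing X (\<lambda>_. 0) {x}) ` N))"
  proof (cases "N = {}")
    case False
    have "closedin (Ck2 X) (\<Inter>((\<lambda>x. agreeing X (\<lambda>_. 0) {x}) ` N))"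
      using False assms by (intro closedin_Inter) (auto intro!: agreeing_clopen(2))
    then show ?thesis
      by (intro closedin_Int closedin_topspace)
  qed simp
  moreover have "topspace (Ck2 X) \<inter> \<Inter>((\<lambda>x. agreeing X (\<lambda>_. 0) {x}) ` N) =
      {g \<in> topspace (Ck2 X). \<forall>x\<in>N. g x = 0}"
    by (auto simp: agreeing_def)
  ultimately show ?thesis
    by simp
qed

lemma strong_Fin_fan_if_noncompact_vanishing:
  fixes X :: "'a topology"
  assumes zd: "zero_dimensional_space X"
    and ctble: "countable \<N>" and closed: "\<And>N. N \<in> \<N> \<Longrightarrow> closedin X N"
    and net: "\<And>K U. compactin X K \<Longrightarrow> openin X U \<Longrightarrow> K \<subseteq> U \<Longrightarrow> \<exists>N\<in>\<N>. K \<subseteq> N \<and> N \<subseteq> U"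
    and cosmic: "cosmic_space (Ck2 X)"
    and nh: "\<not> hemicompact_space X"
    and noncpt: "\<And>K. compactin X K \<Longrightarrow> \<exists>N\<in>\<N>. K \<subseteq> N \<and>
      \<not> compactin (Ck2 X) {g \<in> topspace (Ck2 X). \<forall>x\<in>N. g x = 0}"
  shows "\<exists>F. strong_Fin_fan (Ck2 X) F"
proof -

  \<comment> \<open>Choice of the rows, the clopen families and the points\<close>
  let ?T = "topspace (Ck2 X)" and ?van = "\<lambda>N. {g \<in> topspace (Ck2 X). \<forall>x\<in>N. g x = 0}"
  have netX: "network_in X \<N>"
    unfolding network_in_def
  proof (intro conjI allI impI)
    show "\<Union>\<N> \<subseteq> topspace X"
      using closed closedin_subset by blast
    fix U y assume "openin X U \<and> y \<in> U"
    then show "\<exists>N\<in>\<N>. y \<in> N \<and> N \<subseteq> U"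
      using net[of "{y}" U] openin_subset[of X U] by auto
  qed
  obtain \<C> where \<C>: "countable \<C>" "network_in (Ck2 X) \<C>"
    using cosmic unfolding cosmic_space_def by auto
  have "\<exists>K (A :: nat \<Rightarrow> 'a set). compactin X K \<and> (\<forall>m. closedin X (A m) \<and> \<not> compactin X (A m)) \<and>
      (\<forall>U. openin X U \<and> K \<subseteq> U \<longrightarrow> (\<exists>j. \<forall>m\<ge>j. A m \<subseteq> U))"
    by (rule not_hemicompact_noncompact_sequence[OF nh ctble closed net])
  then obtain K0 and A :: "nat \<Rightarrow> 'a set" where "compactin X K0 \<and>
      (\<forall>m. closedin X (A m) \<and> \<not> compactin X (A m)) \<and>
      (\<forall>U. openin X U \<and> K0 \<subseteq> U \<longrightarrow> (\<exists>j. \<forall>m\<ge>j. A m \<subseteq> U))"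
    by (elim exE) (rule that)
  then have K0: "compactin X K0"
    and A: "\<And>m. closedin X (A m)" "\<And>m. \<not> compactin X (A m)"
    and A_small: "\<And>U. openin X U \<Longrightarrow> K0 \<subseteq> U \<Longrightarrow> \<exists>j. \<forall>m\<ge>j. A m \<subseteq> U"
    by simp_all
  have K0_sub: "K0 \<subseteq> topspace X"
    using compactin_subset_topspace[OF K0] .
  \<comment> \<open>Members contain \<open>K0\<close>, so functions vanishing on them also vanish on
    \<open>K0\<close>. As \<open>D m k\<close> will miss \<open>K0\<close>, the perturbed functions
    still vanish there.\<close>
  define \<M> where "\<M> = {N \<in> \<N>. K0 \<subseteq> N \<and> \<not> compactin (Ck2 X) (?van N)}"
  have "countable \<M>"
    unfolding \<M>_def using ctble by simp
  have "\<M> \<noteq> {}"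
    using noncpt[OF K0] by (auto simp: \<M>_def)
  define M where "M m = from_nat_into \<M> m" for m
  have "M m \<in> \<M>" for m
    unfolding M_def by (rule from_nat_into[OF \<open>\<M> \<noteq> {}\<close>])
  then have M: "M m \<in> \<N>" "K0 \<subseteq> M m" "\<not> compactin (Ck2 X) (?van (M m))" for m
    by (auto simp: \<M>_def)
  have "\<exists>P :: nat \<Rightarrow> ('a \<Rightarrow> real) set. (\<forall>k. openin (Ck2 X) (P k) \<and> closedin (Ck2 X) (P k) \<and>
      P k \<inter> ?van (M m) \<noteq> {}) \<and> locally_finite_family (Ck2 X) P" for m
    by (rule zero_dimensional_noncompact_partition[OF zero_dimensional_Ck2 \<C>
          closedin_Ck2_vanishing[OF closedin_subset[OF closed[OF M(1)]]] M(3)])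
  then have "\<forall>m. \<exists>P :: nat \<Rightarrow> ('a \<Rightarrow> real) set. (\<forall>k. openin (Ck2 X) (P k) \<and> closedin (Ck2 X) (P k) \<and>
      P k \<inter> ?van (M m) \<noteq> {}) \<and> locally_finite_family (Ck2 X) P"
    by (rule allI)
  from choice[OF this] obtain P :: "nat \<Rightarrow> nat \<Rightarrow> ('a \<Rightarrow> real) set" where
    P: "\<And>m k. openin (Ck2 X) (P m k)" "\<And>m k. closedin (Ck2 X) (P m k)"
      "\<And>m k. P m k \<inter> ?van (M m) \<noteq> {}" "\<And>m. locally_finite_family (Ck2 X) (P m)"
    by auto
  have "\<forall>m. \<exists>D :: nat \<Rightarrow> 'a set. (\<forall>k. openin X (D k) \<and> closedin X (D k) \<and> D k \<inter> A m \<noteq> {} \<and> D k \<inter> K0 = {}) \<and>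
      locally_finite_family X D"
    using zero_dimensional_noncompact_partition_off[OF zd ctble netX A K0] by (intro allI)
  from choice[OF this] obtain D :: "nat \<Rightarrow> nat \<Rightarrow> 'a set" where
    D: "\<And>m k. openin X (D m k)" "\<And>m k. closedin X (D m k)" "\<And>m k. D m k \<inter> A m \<noteq> {}"
      "\<And>m k. D m k \<inter> K0 = {}" "\<And>m. locally_finite_family X (D m)"
    by auto
  define b where "b m k = (SOME g. g \<in> P m k \<inter> ?van (M m))" for m k
  have b: "b m k \<in> P m k \<inter> ?van (M m)" for m k
    unfolding b_def some_in_eq by (rule P(3))
  define d where "d m k = (SOME x. x \<in> D m k \<inter> A m)" for m k
  have d: "d m k \<in> D m k \<inter> A m" for m k
    unfolding d_def some_in_eq by (rule D(3))
  have d_X: "d m k \<in> topspace X" for m k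
    using d[of m k] openin_subset[OF D(1)[of m k]] by auto
  have bT: "b m k \<in> ?T" and bM: "x \<in> M m \<Longrightarrow> b m k x = 0" for m k x
    using b[of m k] by auto
  \<comment> \<open>The fan consists of the functions \<open>b m k + c m k\<close> modulo 2, where \<open>c m k\<close> only serves to
    force the value \<open>1\<close> at \<open>d m k\<close>. For fixed \<open>m\<close>, \<open>c m k\<close> tends to \<open>0\<close>, so the sums inherit local
    finiteness from \<open>b m k\<close>; for \<open>m\<close> tending to infinity, compactness is violated along \<open>d m k\<close>.\<close>
  define c where "c m k = char_fun X (if b m k (d m k) = 1 then {} else D m k)" for m k
  have cT: "c m k \<in> ?T" for m k
    unfolding c_def using D(1,2) by (intro char_fun_in_Ck2) auto
  have c0: "c m k x = 0" if "x \<in> topspace X" "x \<notin> D m k" for m k x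
    using that by (simp add: c_def char_fun_def)
  define f where "f m k = symdiff_fun X (b m k) (c m k)" for m k
  have fT: "f m k \<in> ?T" for m k
    unfolding f_def by (intro symdiff_fun_in_Ck2 bT cT)
  have f0: "f m k x = 0" if "x \<in> M m" "x \<notin> D m k" for m k x
    using bM[OF that(1), of k] c0[OF _ that(2)] closedin_subset[OF closed[OF M(1)[of m]]] that(1)
    by (auto simp: f_def symdiff_fun_apply)
  have fd: "f m k (d m k) = 1" for m k
    using Ck2_values[OF bT d_X, of m k m k] d_X[of m k] d[of m k]
    by (auto simp: f_def symdiff_fun_apply c_def char_fun_def)
  \<comment> \<open>The first set is the preimage of \<open>P m k\<close> under translation by
    \<open>c m k\<close> and makes each row locally finite. The conditions on \<open>K0\<close> and
    at \<open>d m k\<close> bound the rows that a compact set can meet.\<close>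
  define U where "U m k = {g \<in> ?T. symdiff_fun X g (c m k) \<in> P m k} \<inter>
      {g \<in> ?T. (\<forall>x\<in>K0. g x = 0) \<and> g (d m k) = 1}" for m k
  have U_clopen: "openin (Ck2 X) (U m k)" "closedin (Ck2 X) (U m k)" for m k
  proof -
    have KD: "compactin X (K0 \<union> {d m k})"
      using K0 d_X by (intro compactin_Un) auto
    have 1: "openin (Ck2 X) {g \<in> ?T. (\<forall>x\<in>K0. g x = 0) \<and> g (d m k) = 1}"
      by (rule Ck2_clopen_by_compact(1)[OF KD]) auto
    have 2: "closedin (Ck2 X) {g \<in> ?T. (\<forall>x\<in>K0. g x = 0) \<and> g (d m k) = 1}"
      by (rule Ck2_clopen_by_compact(2)[OF KD]) auto
    show "openin (Ck2 X) (U m k)"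
      unfolding U_def
      by (intro openin_Int 1 openin_continuous_map_preimage[OF continuous_map_symdiff_fun[OF cT] P(1)])
    show "closedin (Ck2 X) (U m k)"
      unfolding U_def
      by (intro closedin_Int 2 closedin_continuous_map_preimage[OF continuous_map_symdiff_fun[OF cT] P(2)])
  qed
  have fU: "f m k \<in> U m k" for m k
  proof -
    have "symdiff_fun X (f m k) (c m k) \<in> P m k"
      unfolding f_def using symdiff_fun_cancel[OF bT cT] b by simp
    moreover have "f m k x = 0" if "x \<in> K0" for x
      using that M(2)[of m] D(4)[of m k] by (intro f0) auto
    ultimately show ?thesis
      using fT fd by (simp add: U_def)
  qed

  \<comment> \<open>Compact-finiteness of the clopen neighbourhoods\<close>
  have D_fin: "finite {k. D m k \<inter> K \<noteq> {}}" if "compactin X K" for m K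
    using locally_finite_imp_compact_finite[OF D(5)] that by (simp add: compact_finite_family_def)
  have "locally_finite_family (Ck2 X) (U m)" for m
    unfolding locally_finite_family_def
  proof
    fix h assume h: "h \<in> ?T"
    then obtain V where V: "openin (Ck2 X) V" "h \<in> V" "finite {k. P m k \<inter> V \<noteq> {}}"
      using P(4)[of m] unfolding locally_finite_family_def by auto
    then obtain K where K: "compactin X K" "agreeing X h K \<subseteq> V"
      unfolding openin_Ck2_iff by auto
    \<comment> \<open>Here \<open>c m k\<close> vanishes on \<open>K\<close>, so translation by it
      keeps the values on \<open>K\<close>: a common element would be carried into both
      \<open>P m k\<close> and \<open>V\<close>.\<close>
    have "U m k \<inter> agreeing X h K = {}" if k: "P m k \<inter> V = {}" "D m k \<inter> K = {}" for k
    proof (rule ccontr)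
      assume "U m k \<inter> agreeing X h K \<noteq> {}"
      then obtain g where g: "g \<in> U m k" "g \<in> agreeing X h K"
        by auto
      have gT: "g \<in> ?T"
        using g(2) by (simp add: agreeing_def)
      have "symdiff_fun X g (c m k) x = h x" if "x \<in> K" for x
      proof -
        have "x \<in> topspace X" "c m k x = 0"
          using that k(2) compactin_subset_topspace[OF K(1)] c0[of x m k] by auto
        moreover have "g x = h x"
          using g(2) that by (simp add: agreeing_def)
        ultimately show ?thesis
          using Ck2_values[OF gT, of x] by (auto simp: symdiff_fun_apply)
      qed
      then have "symdiff_fun X g (c m k) \<in> V"
        using symdiff_fun_in_Ck2[OF gT cT] K(2) by (auto simp: agreeing_def)
      moreover have "symdiff_fun X g (c m k) \<in> P m k"
        using g(1) by (simp add: U_def)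
      ultimately show False
        using k(1) by auto
    qed
    then have "{k. U m k \<inter> agreeing X h K \<noteq> {}} \<subseteq> {k. P m k \<inter> V \<noteq> {}} \<union> {k. D m k \<inter> K \<noteq> {}}"
      by auto
    then have "finite {k. U m k \<inter> agreeing X h K \<noteq> {}}"
      using V(3) D_fin[OF K(1)] finite_subset by (metis finite_UnI)
    then show "\<exists>V. openin (Ck2 X) V \<and> h \<in> V \<and> finite {k. U m k \<inter> V \<noteq> {}}"
      using h agreeing_clopen(1)[OF K(1)] by (intro exI[of _ "agreeing X h K"]) (simp add: agreeing_def)
  qed
  then have U_slice: "finite {k. U m k \<inter> Q \<noteq> {}}" if "compactin (Ck2 X) Q" for m Q
    using locally_finite_imp_compact_finite that by (auto simp: compact_finite_family_def)

  \<comment> \<open>Given infinitely many rows meeting \<open>Q\<close>, take one column in each.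
    The corresponding points form with \<open>K0\<close> a compact set, to which \<open>Q\<close>
    has only finitely many restrictions. Each representative vanishing on \<open>K0\<close> vanishes
    at \<open>d m k\<close> for all large \<open>m\<close>, while membership in \<open>U m k\<close>
    forces the value 1 there.\<close>
  have U_rows: "finite {m. \<exists>k. U m k \<inter> Q \<noteq> {}}" if Q: "compactin (Ck2 X) Q" for Q
  proof (rule ccontr)
    define I where "I = {m. \<exists>k. U m k \<inter> Q \<noteq> {}}"
    assume "infinite {m. \<exists>k. U m k \<inter> Q \<noteq> {}}"
    then have "infinite I"
      by (simp add: I_def)
    have "\<forall>m. \<exists>k. m \<in> I \<longrightarrow> U m k \<inter> Q \<noteq> {}"
      by (auto simp: I_def)
    from choice[OF this] obtain \<kappa> where \<kappa>: "\<And>m. m \<in> I \<Longrightarrow> U m (\<kappa> m) \<inter> Q \<noteq> {}"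
      by auto
    define S where "S = (\<lambda>m. d m (\<kappa> m)) ` I"
    have "compactin X (K0 \<union> S)"
    proof (rule compactin_Un_almost_covered[OF K0])
      show "S \<subseteq> topspace X"
        using d_X by (auto simp: S_def)
      fix V assume "openin X V" "K0 \<subseteq> V"
      then obtain j where j: "\<forall>m\<ge>j. A m \<subseteq> V"
        using A_small[of V] by auto
      have "S - V \<subseteq> (\<lambda>m. d m (\<kappa> m)) ` {..<j}"
      proof
        fix x assume "x \<in> S - V"
        then obtain m where m: "x = d m (\<kappa> m)" "x \<notin> V"
          by (auto simp: S_def)
        then have "\<not> j \<le> m"
          using j d[of m "\<kappa> m"] by auto
        then show "x \<in> (\<lambda>m. d m (\<kappa> m)) ` {..<j}"
          using m(1) by auto
      qed
      then show "finite (S - V)"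
        using finite_subset by blast
    qed
    from compactin_Ck2_finite_restrictions[OF Q this] obtain E where
      E: "finite E" "E \<subseteq> Q" "\<forall>g\<in>Q. \<exists>e\<in>E. \<forall>x\<in>K0 \<union> S. g x = e x"
      by auto
    \<comment> \<open>The zero set of such an \<open>e\<close> is an open set around
      \<open>K0\<close>, hence contains \<open>A m\<close> for large \<open>m\<close>, and with it
      all points \<open>d m k\<close> of the row at once.\<close>
    have "\<exists>j. \<forall>m\<ge>j. (\<forall>x\<in>K0. e x = 0) \<longrightarrow> (\<forall>k. e (d m k) = 0)" if "e \<in> E" for e
    proof (cases "\<forall>x\<in>K0. e x = 0")
      case True
      have eT: "e \<in> ?T"
        using that E(2) compactin_subset_topspace[OF Q] by auto
      have "K0 \<subseteq> {x \<in> topspace X. e x = 0}"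
        using True K0_sub by auto
      then obtain j where j: "\<forall>m\<ge>j. A m \<subseteq> {x \<in> topspace X. e x = 0}"
        using A_small[OF Ck2_fibre(1)[OF eT, of 0]] by (elim meta_impE exE)
      have "e (d m k) = 0" if "j \<le> m" for m k
        using j that d[of m k] by auto
      then show ?thesis
        by auto
    qed auto
    then have "\<forall>e. \<exists>j. e \<in> E \<longrightarrow> (\<forall>m\<ge>j. (\<forall>x\<in>K0. e x = 0) \<longrightarrow> (\<forall>k. e (d m k) = 0))"
      by auto
    from choice[OF this] obtain J where
      "\<forall>e. e \<in> E \<longrightarrow> (\<forall>m\<ge>J e. (\<forall>x\<in>K0. e x = 0) \<longrightarrow> (\<forall>k. e (d m k) = 0))"
      by (rule exE)
    then have J: "\<And>e m k. e \<in> E \<Longrightarrow> J e \<le> m \<Longrightarrow> \<forall>x\<in>K0. e x = 0 \<Longrightarrow> e (d m k) = 0"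
      by blast
    obtain j where j: "\<forall>i\<in>J ` E. i < j"
      using E(1) finite_nat_set_iff_bounded[of "J ` E"] by auto
    obtain m where m: "m \<in> I" "j < m"
      using \<open>infinite I\<close> unfolding infinite_nat_iff_unbounded by auto
    obtain g where g: "g \<in> U m (\<kappa> m)" "g \<in> Q"
      using \<kappa>[OF m(1)] by auto
    obtain e where e: "e \<in> E" "\<forall>x\<in>K0 \<union> S. g x = e x"
      using E(3) g(2) by auto
    have "\<forall>x\<in>K0. e x = 0" "g (d m (\<kappa> m)) = 1"
      using g(1) e(2) by (auto simp: U_def)
    moreover have "d m (\<kappa> m) \<in> S"
      using m(1) by (simp add: S_def)
    moreover have "J e \<le> m"
      using j e(1) m(2) by (auto intro: less_imp_le less_trans)
    ultimately have "e (d m (\<kappa> m)) = 0" "e (d m (\<kappa> m)) = 1"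
      using J[OF e(1)] e(2) by auto
    then show False
      by simp
  qed

  \<comment> \<open>The fan at the zero function\<close>
  define \<U> where "\<U> n = (case prod_decode n of (m, k) \<Rightarrow> U m k)" for n
  define F where "F n = (case prod_decode n of (m, k) \<Rightarrow> {f m k})" for n
  have FU: "F n \<subseteq> \<U> n" for n
    unfolding F_def \<U>_def using fU by (auto split: prod.split)
  have \<U>_cf: "compact_finite_family (Ck2 X) \<U>"
    unfolding compact_finite_family_def
  proof (intro allI impI)
    fix Q assume Q: "compactin (Ck2 X) Q"
    let ?R = "SIGMA m:{m. \<exists>k. U m k \<inter> Q \<noteq> {}}. {k. U m k \<inter> Q \<noteq> {}}"
    have "finite ?R"
      using U_rows[OF Q] U_slice[OF Q] by (intro finite_SigmaI)
    moreover have "{n. \<U> n \<inter> Q \<noteq> {}} \<subseteq> prod_encode ` ?R"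
    proof
      fix n assume n: "n \<in> {n. \<U> n \<inter> Q \<noteq> {}}"
      obtain m k where mk: "prod_decode n = (m, k)"
        by (cases "prod_decode n")
      then have "n = prod_encode (m, k)"
        by (metis prod_decode_inverse)
      moreover have "U m k \<inter> Q \<noteq> {}"
        using n mk by (simp add: \<U>_def)
      ultimately show "n \<in> prod_encode ` ?R"
        by (intro image_eqI[of _ _ "(m, k)"]) auto
    qed
    ultimately show "finite {n. \<U> n \<inter> Q \<noteq> {}}"
      using finite_surj by blast
  qed
  have "compact_finite_family (Ck2 X) F"
    unfolding compact_finite_family_def
  proof (intro allI impI)
    fix Q assume "compactin (Ck2 X) Q"
    then have "finite {n. \<U> n \<inter> Q \<noteq> {}}"
      using \<U>_cf by (simp add: compact_finite_family_def)
    moreover have "{n. F n \<inter> Q \<noteq> {}} \<subseteq> {n. \<U> n \<inter> Q \<noteq> {}}"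
      using FU by auto
    ultimately show "finite {n. F n \<inter> Q \<noteq> {}}"
      by (rule finite_subset[rotated])
  qed
  moreover have "\<not> locally_finite_family (Ck2 X) F"
  proof
    let ?z = "char_fun X {}"
    assume "locally_finite_family (Ck2 X) F"
    moreover have z: "?z \<in> ?T"
      by (rule char_fun_in_Ck2) auto
    ultimately obtain V where V: "openin (Ck2 X) V" "?z \<in> V" "finite {n. F n \<inter> V \<noteq> {}}"
      unfolding locally_finite_family_def by auto
    then obtain K where K: "compactin X K" "agreeing X ?z K \<subseteq> V"
      unfolding openin_Ck2_iff by auto
    \<comment> \<open>Adding \<open>K0\<close> makes \<open>N\<close> one of the sets indexing the
      rows. Functions of that row vanish on \<open>K\<close> unless \<open>D m k\<close> meets
      \<open>K\<close>, so all but finitely many of them lie in \<open>V\<close>.\<close>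
    obtain N where N: "N \<in> \<N>" "K \<union> K0 \<subseteq> N" "\<not> compactin (Ck2 X) (?van N)"
      using noncpt[OF compactin_Un[OF K(1) K0]] by auto
    then have "N \<in> \<M>"
      by (simp add: \<M>_def)
    then obtain m where m: "M m = N"
      using from_nat_into_surj[OF \<open>countable \<M>\<close>] unfolding M_def by auto
    have "f m k \<in> V" if "D m k \<inter> K = {}" for k
    proof -
      have "f m k x = ?z x" if "x \<in> K" for x
        using f0[of x m k] that \<open>D m k \<inter> K = {}\<close> m N(2) compactin_subset_topspace[OF K(1)]
        by (auto simp: char_fun_def)
      then show ?thesis
        using K(2) fT by (auto simp: agreeing_def)
    qed
    then have "- {k. D m k \<inter> K \<noteq> {}} \<subseteq> {k. f m k \<in> V}"
      by auto
    then have "infinite {k. f m k \<in> V}"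
      using D_fin[OF K(1), of m] by (meson finite_compl infinite_UNIV_nat finite_subset)
    then have "infinite ((\<lambda>k. prod_encode (m, k)) ` {k. f m k \<in> V})"
      by (subst finite_image_iff) (auto simp: inj_on_def)
    moreover have "(\<lambda>k. prod_encode (m, k)) ` {k. f m k \<in> V} \<subseteq> {n. F n \<inter> V \<noteq> {}}"
      by (auto simp: F_def)
    ultimately show False
      using V(3) finite_subset by blast
  qed
  moreover have "finite (F n)" "F n \<subseteq> ?T" for n
    unfolding F_def using fT by (auto split: prod.split)
  moreover have "R_open_in (Ck2 X) (\<U> n)" for n
    unfolding \<U>_def using U_clopen by (auto split: prod.split intro: clopen_imp_R_open)
  ultimately have "strong_Fin_fan (Ck2 X) F"
    unfolding strong_Fin_fan_def Fin_fan_def using FU \<U>_cf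
    by (intro conjI exI[of _ \<U>]) simp_all
  then show ?thesis
    by auto
qed

theorem theorem1p11:
  fixes X :: "'a topology"
  assumes "zero_dimensional_space X" and "aleph0_space X"
  shows "(metrizable_space (Ck2 X) \<or> cosmic_space (Ck2 X) \<and> k_omega_space (Ck2 X)
            \<longleftrightarrow> sequential_space (Ck2 X))
       \<and> (sequential_space (Ck2 X) \<longleftrightarrow> \<not> (\<exists>F. strong_Fin_fan (Ck2 X) F))
       \<and> (\<not> (\<exists>F. strong_Fin_fan (Ck2 X) F)
            \<longleftrightarrow> hemicompact_space X
                \<or> metrizable_space X \<and> compactin X (non_isolated_points X))"
proof -
  have cosmic: "cosmic_space (Ck2 X)"
    using assms(2) by (rule cosmic_space_Ck2)
  have t1: "t1_space X"
    using assms(2) by (simp add: aleph0_space_def)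
  have 12: "sequential_space (Ck2 X)"
    if "metrizable_space (Ck2 X) \<or> cosmic_space (Ck2 X) \<and> k_omega_space (Ck2 X)"
    using that metrizable_imp_sequential_space cosmic_k_omega_imp_sequential_space by auto
  have 23: "\<not> (\<exists>F. strong_Fin_fan (Ck2 X) F)" if "sequential_space (Ck2 X)"
    using sequential_imp_no_Fin_fan[OF that t1_space_Ck2] by (auto simp: strong_Fin_fan_def)
  have 34: "hemicompact_space X \<or> metrizable_space X \<and> compactin X (non_isolated_points X)"
    if no_fan: "\<not> (\<exists>F. strong_Fin_fan (Ck2 X) F)"
  proof (rule ccontr)
    assume not4: "\<not> ?thesis"
    obtain \<N> where "countable \<N> \<and> (\<forall>N\<in>\<N>. closedin X N) \<and> (\<forall>M\<in>\<N>. \<forall>N\<in>\<N>. M \<union> N \<in> \<N>) \<and>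
        (\<forall>K U. compactin X K \<and> openin X U \<and> K \<subseteq> U \<longrightarrow> (\<exists>N\<in>\<N>. K \<subseteq> N \<and> N \<subseteq> U))"
      using closed_k_network[OF assms] by (rule exE)
    then have \<N>: "countable \<N>" "\<And>N. N \<in> \<N> \<Longrightarrow> closedin X N"
      "\<And>M N. M \<in> \<N> \<Longrightarrow> N \<in> \<N> \<Longrightarrow> M \<union> N \<in> \<N>"
      "\<And>K U. compactin X K \<Longrightarrow> openin X U \<Longrightarrow> K \<subseteq> U \<Longrightarrow> \<exists>N\<in>\<N>. K \<subseteq> N \<and> N \<subseteq> U"
      by simp_all
    \<comment> \<open>Failure for one compact \<open>K\<close> would make all the relevant sets of
      vanishing functions compact and so yield the metrizable alternative.\<close>
    have "\<exists>N\<in>\<N>. K \<subseteq> N \<and> \<not> compactin (Ck2 X) {g \<in> topspace (Ck2 X). \<forall>x\<in>N. g x = 0}"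
      if K: "compactin X K" for K
    proof (rule ccontr)
      assume "\<not> ?thesis"
      then have cpt: "compactin (Ck2 X) {g \<in> topspace (Ck2 X). \<forall>x\<in>N. g x = 0}" if "N \<in> \<N>" "K \<subseteq> N" for N
        using that by auto
      have "metrizable_space X"
        by (rule compact_vanishing_imp_metrizable(1)[OF assms(1) t1 \<N> K cpt])
      moreover have "compactin X (non_isolated_points X)"
        by (rule compact_vanishing_imp_metrizable(2)[OF assms(1) t1 \<N> K cpt])
      ultimately show False
        using not4 by simp
    qed
    then have "\<exists>F. strong_Fin_fan (Ck2 X) F"
      using not4 by (intro strong_Fin_fan_if_noncompact_vanishing[OF assms(1) \<N>(1,2,4) cosmic]) auto
    then show False
      using no_fan by simp
  qed
  have 41: "metrizable_space (Ck2 X) \<or> cosmic_space (Ck2 X) \<and> k_omega_space (Ck2 X)"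
    if "hemicompact_space X \<or> metrizable_space X \<and> compactin X (non_isolated_points X)"
    using that hemicompact_imp_metrizable_Ck2 cosmic
      metrizable_compact_derived_imp_k_omega_Ck2[OF assms(2)] by auto
  show ?thesis
    using 12 23 34 41 by argo
qed

end
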